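(* Let $k\ge2$ and let $\mathcal{O}\subset\Omega_N^{\mathbb{R},+}\times\mathcal{B}^{\mathbb{C}}$ be such that each $(\boldsymbol\omega,\mathbf{A})\in\mathcal{O}$ has exactly $k$ eigenvalues. Let $(\boldsymbol\omega_0,\mathbf{A}_0)\in\bar{\mathcal{O}}\setminus\mathcal{O}$ have exactly $m$ eigenvalues for some $0<m\le k-1$. All limits below are taken as $(\boldsymbol\omega,\mathbf{A})\to(\boldsymbol\omega_0,\mathbf{A}_0)$ with $(\boldsymbol\omega,\mathbf{A})\in\mathcal{O}$. (i) If $\lim\lambda_n(\boldsymbol\omega,\mathbf{A})=-\infty$ for $0\le n\le k-m-1$, then $\lim\lambda_n(\boldsymbol\omega,\mathbf{A})=\lambda_{n-k+m}(\boldsymbol\omega_0,\mathbf{A}_0)$ for $k-m\le n\le k-1$. (ii) If $\lim\lambda_n(\boldsymbol\omega,\mathbf{A})=+\infty$ for $m\le n\le k-1$, then $\lim\lambda_n(\boldsymbol\omega,\mathbf{A})=\lambda_n(\boldsymbol\omega_0,\mathbf{A}_0)$ for $0\le n\le m-1$.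
   Context: Fix an integer $N\ge 2$. A self-adjoint discrete Sturm–Liouville problem (SLP) is a pair $(\boldsymbol\omega,\mathbf{A})$. Here $\boldsymbol\omega=(1/f,q,w)$ with real sequences $f=\{f_n\}_{n=0}^N$, $q=\{q_n\}_{n=1}^N$, $w=\{w_n\}_{n=1}^N$, $f_n\ne0$, $w_n>0$, encodes the equation $-\nabla(f_n\Delta y_n)+q_ny_n=\lambda w_ny_n$, $1\le n\le N$, for $y=(y_0,\dots,y_{N+1})$, with $\Delta y_n=y_{n+1}-y_n$, $\nabla y_n=y_n-y_{n-1}$; the set $\Omega_N^{\mathbb{R},+}$ of all such $(1/f,q,w)$ has the topology of a subset of $\mathbb{R}^{3N+1}$. $\mathbf{A}=[A\,|\,B]$ encodes the boundary condition $A\begin{pmatrix}y_0\\ f_0\Delta y_0\end{pmatrix}+B\begin{pmatrix}y_N\\ f_N\Delta y_N\end{pmatrix}=0$, where $A,B$ are complex $2\times2$ matrices with $\mathrm{rank}(A,B)=2$ and $AJA^*=BJB^*$, $J=\begin{pmatrix}0&1\\-1&0\end{pmatrix}$; $[A\,|\,B]$ is the class of the $2\times4$ matrix $(A,B)$ modulo left multiplication by $GL(2,\mathbb{C})$, and $\mathcal{B}^{\mathbb{C}}$ is the set of all such classes, topologized as a subspace of the quotient of the rank-2 complex $2\times 4$ matrices by $GL(2,\mathbb{C})$. $\Omega_N^{\mathbb{R},+}\times\mathcal{B}^{\mathbb{C}}$ has the product topology, and $\bar{\mathcal{O}}$ is the closure of $\mathcal{O}$ in it. An eigenvalue of $(\boldsymbol\omega,\mathbf{A})$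 is a $\lambda$ for which a nonzero $y$ solves the equation and the boundary condition. Eigenvalues are real and finite in number; they are counted with multiplicity (the dimension of the solution space) and listed as $\lambda_0(\boldsymbol\omega,\mathbf{A})\le\lambda_1(\boldsymbol\omega,\mathbf{A})\le\cdots$. *)

theory Defs
  imports "HOL-Analysis.Analysis" "HOL-Library.Multiset" "HOL-Library.Function_Algebras"
begin

section \<open>Equations\<close>

text \<open>
  An equation is a triple (g, q, w) of real sequences, where the first component is 1/f and not
  f itself. Since N is a variable, the vectors are functions on the naturals which take the
  value \<open>undefined\<close> off their index set, as required by \<^const>\<open>product_topology\<close>.
\<close>

type_synonym sl_equation = "(nat \<Rightarrow> real) \<times> (nat \<Rightarrow> real) \<times> (nat \<Rightarrow> real)"

definition coeff_topology :: "nat \<Rightarrow> sl_equation topology" where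
  "coeff_topology N =
     prod_topology (product_topology (\<lambda>_. euclideanreal) {0..N})
       (prod_topology (product_topology (\<lambda>_. euclideanreal) {1..N})
         (product_topology (\<lambda>_. euclideanreal) {1..N}))"

definition sl_equations :: "nat \<Rightarrow> sl_equation set" where
  "sl_equations N =
     {(g, q, w) \<in> topspace (coeff_topology N).
        (\<forall>n\<in>{0..N}. g n \<noteq> 0) \<and> (\<forall>n\<in>{1..N}. w n > 0)}"

definition sl_f :: "sl_equation \<Rightarrow> nat \<Rightarrow> real" where
  "sl_f \<omega> n = 1 / fst \<omega> n"

definition sl_q :: "sl_equation \<Rightarrow> nat \<Rightarrow> real" where
  "sl_q \<omega> = fst (snd \<omega>)"

definition sl_w :: "sl_equation \<Rightarrow> nat \<Rightarrow> real" where
  "sl_w \<omega> = snd (snd \<omega>)"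

definition fwd_diff :: "(nat \<Rightarrow> complex) \<Rightarrow> nat \<Rightarrow> complex" where
  "fwd_diff y n = y (n + 1) - y n"

text \<open>The index is truncated at 0; only indices n of at least 1 are used.\<close>

definition bwd_diff :: "(nat \<Rightarrow> complex) \<Rightarrow> nat \<Rightarrow> complex" where
  "bwd_diff y n = y n - y (n - 1)"

definition quasi_diff :: "sl_equation \<Rightarrow> (nat \<Rightarrow> complex) \<Rightarrow> nat \<Rightarrow> complex" where
  "quasi_diff \<omega> y n = complex_of_real (sl_f \<omega> n) * fwd_diff y n"

definition solves_equation ::
    "nat \<Rightarrow> sl_equation \<Rightarrow> complex \<Rightarrow> (nat \<Rightarrow> complex) \<Rightarrow> bool" where
  "solves_equation N \<omega> lam y \<longleftrightarrow>
     (\<forall>n\<in>{1..N}. - bwd_diff (quasi_diff \<omega> y) n + complex_of_real (sl_q \<omega> n) * y n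
                  = lam * complex_of_real (sl_w \<omega> n) * y n)"

section \<open>Boundary conditions\<close>

text \<open>The columns of a 2 by 4 matrix (A, B) are indexed by the sum type \<open>2 + 2\<close>: the columns
  of A by \<open>Inl\<close>, those of B by \<open>Inr\<close>.\<close>

type_synonym bc_matrix = "complex^(2 + 2)^2"

definition left_block :: "bc_matrix \<Rightarrow> complex^2^2" where
  "left_block M = (\<chi> i j. M $ i $ Inl j)"

definition right_block :: "bc_matrix \<Rightarrow> complex^2^2" where
  "right_block M = (\<chi> i j. M $ i $ Inr j)"

definition conj_transpose :: "complex^'n^'m \<Rightarrow> complex^'m^'n" where
  "conj_transpose A = (\<chi> i j. cnj (A $ j $ i))"

definition symplectic_J :: "complex^2^2" where
  "symplectic_J = vector [vector [0, 1], vector [-1, 0]]"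

definition self_adjoint_matrix :: "bc_matrix \<Rightarrow> bool" where
  "self_adjoint_matrix M \<longleftrightarrow>
     left_block M ** symplectic_J ** conj_transpose (left_block M) =
     right_block M ** symplectic_J ** conj_transpose (right_block M)"

definition bc_class :: "bc_matrix \<Rightarrow> bc_matrix set" where
  "bc_class M = {G ** M | G :: complex^2^2. invertible G}"

definition sa_boundary_conditions :: "bc_matrix set set" where
  "sa_boundary_conditions = bc_class ` {M. rank M = 2 \<and> self_adjoint_matrix M}"

definition quotient_topology :: "'a topology \<Rightarrow> ('a \<Rightarrow> 'b) \<Rightarrow> 'b topology" where
  "quotient_topology X p =
     topology (\<lambda>U. U \<subseteq> p ` topspace X \<and> openin X {x \<in> topspace X. p x \<in> U})"

lemma openin_quotient_topology:
  "openin (quotient_topology X p) U \<longleftrightarrow>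
     U \<subseteq> p ` topspace X \<and> openin X {x \<in> topspace X. p x \<in> U}"
proof -
  have "istopology (\<lambda>U. U \<subseteq> p ` topspace X \<and> openin X {x \<in> topspace X. p x \<in> U})"
  proof (unfold istopology_def, intro conjI allI impI)
    fix S T
    assume *: "S \<subseteq> p ` topspace X \<and> openin X {x \<in> topspace X. p x \<in> S}"
              "T \<subseteq> p ` topspace X \<and> openin X {x \<in> topspace X. p x \<in> T}"
    show "S \<inter> T \<subseteq> p ` topspace X" using * by blast
    have "{x \<in> topspace X. p x \<in> S \<inter> T} =
          {x \<in> topspace X. p x \<in> S} \<inter> {x \<in> topspace X. p x \<in> T}" by blast
    then show "openin X {x \<in> topspace X. p x \<in> S \<inter> T}" using * by auto
  next
    fix K
    assume *: "\<forall>U\<in>K. U \<subseteq> p ` topspace X \<and> openin X {x \<in> topspace X. p x \<in> U}"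
    show "\<Union>K \<subseteq> p ` topspace X" using * by blast
    have "{x \<in> topspace X. p x \<in> \<Union>K} = (\<Union>U\<in>K. {x \<in> topspace X. p x \<in> U})" by blast
    then show "openin X {x \<in> topspace X. p x \<in> \<Union>K}" using * by auto
  qed
  then show ?thesis
    by (simp add: quotient_topology_def topology_inverse')
qed

lemma topspace_quotient_topology: "topspace (quotient_topology X p) = p ` topspace X"
proof
  show "topspace (quotient_topology X p) \<subseteq> p ` topspace X"
    by (metis openin_quotient_topology openin_topspace)
  have "{x \<in> topspace X. p x \<in> p ` topspace X} = topspace X" by blast
  then have "openin (quotient_topology X p) (p ` topspace X)"
    by (simp add: openin_quotient_topology)
  then show "p ` topspace X \<subseteq> topspace (quotient_topology X p)"
    by (rule openin_subset)
qed

lemma quotient_map_quotient_topology: "quotient_map X (quotient_topology X p) p"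
  by (simp add: quotient_map_def openin_quotient_topology topspace_quotient_topology)

definition bc_topology :: "bc_matrix set topology" where
  "bc_topology =
     subtopology (quotient_topology (top_of_set {M. rank M = 2}) bc_class)
       sa_boundary_conditions"

section \<open>Self-adjoint Sturm-Liouville problems\<close>

type_synonym slp = "sl_equation \<times> bc_matrix set"

definition slp_topology :: "nat \<Rightarrow> slp topology" where
  "slp_topology N = prod_topology (subtopology (coeff_topology N) (sl_equations N)) bc_topology"

lemma topspace_slp_topology:
  "topspace (slp_topology N) = sl_equations N \<times> sa_boundary_conditions"
  by (auto simp: slp_topology_def bc_topology_def topspace_quotient_topology
      sl_equations_def sa_boundary_conditions_def)

definition boundary_values :: "sl_equation \<Rightarrow> (nat \<Rightarrow> complex) \<Rightarrow> nat \<Rightarrow> complex^2" where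
  "boundary_values \<omega> y n = vector [y n, quasi_diff \<omega> y n]"

text \<open>The representatives of a class all give the same condition, so the quantifier could as
  well be existential.\<close>

definition satisfies_bc ::
    "nat \<Rightarrow> sl_equation \<Rightarrow> bc_matrix set \<Rightarrow> (nat \<Rightarrow> complex) \<Rightarrow> bool" where
  "satisfies_bc N \<omega> \<A> y \<longleftrightarrow>
     (\<forall>M\<in>\<A>. left_block M *v boundary_values \<omega> y 0 + right_block M *v boundary_values \<omega> y N = 0)"

text \<open>A vector \<open>(y_0, \<dots>, y_{N+1})\<close> is a function vanishing beyond N + 1.\<close>

definition solution_space :: "nat \<Rightarrow> slp \<Rightarrow> complex \<Rightarrow> (nat \<Rightarrow> complex) set" where
  "solution_space N P lam =
     {y. (\<forall>n>N + 1. y n = 0) \<and> solves_equation N (fst P) lam y \<and> satisfies_bc N (fst P) (snd P) y}"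

global_interpretation cseq: vector_space "\<lambda>(c::complex) (y::nat \<Rightarrow> complex) n. c * y n"
  by unfold_locales (auto simp: fun_eq_iff algebra_simps)

text \<open>Eigenvalues are a priori complex.\<close>

definition eigenvalues :: "nat \<Rightarrow> slp \<Rightarrow> complex set" where
  "eigenvalues N P = {lam. \<exists>y\<in>solution_space N P lam. y \<noteq> (\<lambda>_. 0)}"

definition multiplicity_of :: "nat \<Rightarrow> slp \<Rightarrow> complex \<Rightarrow> nat" where
  "multiplicity_of N P lam = cseq.dim (solution_space N P lam)"

definition eigenvalue_mset :: "nat \<Rightarrow> slp \<Rightarrow> complex multiset" where
  "eigenvalue_mset N P = (\<Sum>lam\<in>eigenvalues N P. replicate_mset (multiplicity_of N P lam) lam)"

definition num_eigenvalues :: "nat \<Rightarrow> slp \<Rightarrow> nat" where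
  "num_eigenvalues N P = size (eigenvalue_mset N P)"

text \<open>The n-th eigenvalue, counted from 0 in increasing order with multiplicity, for n below
  \<open>num_eigenvalues N P\<close>. The eigenvalues of a self-adjoint problem being real, \<^const>\<open>Re\<close> only
  changes the type.\<close>

definition eigenvalue :: "nat \<Rightarrow> nat \<Rightarrow> slp \<Rightarrow> real" where
  "eigenvalue N n P = sorted_list_of_multiset (image_mset Re (eigenvalue_mset N P)) ! n"

end

(*
  A problem (omega, [A|B]) is a self-adjoint linear relation on C^N with the inner product
  <x, y> = sum w_n x_n cnj(y_n): the pairs (y, l y), restricted to the indices 1..N, where y runs
  through the N-dimensional space of sequences satisfying the boundary condition. Its eigenvalues
  are those of a self-adjoint operator on its domain, so the eigenfunctions form an orthonormal
  basis of the domain. Hence d functions spanning a space on which |l y - c y| < r |y| force d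
  eigenvalues in [c - r, c + r]. The null space of (A, B) is parametrised by (J A^* c, - J B^* c),
  which is continuous in (A, B); so finitely many eigenfunctions of the limit problem deform into
  such functions for all nearby problems. Thus the number of eigenvalues near [a, b] is lower
  semicontinuous. As the k - m escaping eigenvalues leave only m others, this lower bound
  determines the limits of these.
*)

theory Submission
  imports Defs
begin

section \<open>Boundary conditions\<close>

text \<open>The obstacle is that the relation can be multivalued: l y at 1 and N involves
  \<open>y 0\<close> and \<open>y (N + 1)\<close>, which the values on 1..N may leave undetermined.
  Then the domain, restricted to 1..N, is a proper subspace of C^N, there are fewer than N
  eigenvalues, and no N by N matrix is at hand whose spectrum could be followed. So the operator
  acts on whole sequences, and its spectral decomposition is obtained by maximising over a sphere in
  the graph norm, where compactness survives. Two objects near the limit problem come without a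
  continuous choice: the matrix representing a boundary class and the eigenbasis. The first is
  handled by openness of the projection to classes; the second by deforming eigenfunctions of the
  limit problem only, as trial functions.\<close>

definition sl_operator :: "sl_equation \<Rightarrow> (nat \<Rightarrow> complex) \<Rightarrow> nat \<Rightarrow> complex" where
  "sl_operator \<omega> y n =
     (- bwd_diff (quasi_diff \<omega> y) n + complex_of_real (sl_q \<omega> n) * y n) / complex_of_real (sl_w \<omega> n)"

definition sl_inner :: "nat \<Rightarrow> sl_equation \<Rightarrow> (nat \<Rightarrow> complex) \<Rightarrow> (nat \<Rightarrow> complex) \<Rightarrow> complex" where
  "sl_inner N \<omega> x y = (\<Sum>n=1..N. complex_of_real (sl_w \<omega> n) * x n * cnj (y n))"

definition vec4 :: "complex \<Rightarrow> complex \<Rightarrow> complex \<Rightarrow> complex \<Rightarrow> complex^(2 + 2)" where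
  "vec4 a b c d = (\<chi> i. case i of Inl j \<Rightarrow> if j = 1 then a else b | Inr j \<Rightarrow> if j = 1 then c else d)"

definition boundary_vector :: "nat \<Rightarrow> sl_equation \<Rightarrow> (nat \<Rightarrow> complex) \<Rightarrow> complex^(2 + 2)" where
  "boundary_vector N \<omega> y = vec4 (y 0) (quasi_diff \<omega> y 0) (y N) (quasi_diff \<omega> y N)"

definition sl_domain :: "nat \<Rightarrow> sl_equation \<Rightarrow> bc_matrix \<Rightarrow> (nat \<Rightarrow> complex) set" where
  "sl_domain N \<omega> M = {y. (\<forall>n>N + 1. y n = 0) \<and> M *v boundary_vector N \<omega> y = 0}"

section \<open>Coordinates of the boundary data and the null space of (A, B)\<close>

lemma vec4_nth [simp]:
  "vec4 a b c d $ Inl 1 = a" "vec4 a b c d $ Inl 2 = b"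
  "vec4 a b c d $ Inr 1 = c" "vec4 a b c d $ Inr 2 = d"
  by (simp_all add: vec4_def)

lemma sum_2p2: "(\<Sum>i\<in>UNIV. h i) = h (Inl 1) + h (Inl 2) + h (Inr 1) + h (Inr (2::2))"
  for h :: "2 + 2 \<Rightarrow> complex"
proof -
  have "(\<Sum>i\<in>UNIV. h i) = (\<Sum>i\<in>UNIV <+> UNIV. h i)"
    by simp
  also have "\<dots> = (\<Sum>i\<in>UNIV. h (Inl i)) + (\<Sum>i\<in>UNIV. h (Inr i))"
    by (subst sum.Plus) (auto simp: o_def)
  finally show ?thesis
    by (simp add: sum_2)
qed

lemma forall_2p2: "(\<forall>i::2 + 2. Q i) \<longleftrightarrow> Q (Inl 1) \<and> Q (Inl 2) \<and> Q (Inr 1) \<and> Q (Inr 2)"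
  by (auto simp: split_sum_all forall_2)

lemma vec4_eq_iff:
  "b = b' \<longleftrightarrow> b $ Inl 1 = b' $ Inl 1 \<and> b $ Inl 2 = b' $ Inl 2 \<and> b $ Inr 1 = b' $ Inr 1 \<and> b $ Inr 2 = b' $ Inr 2"
  for b :: "complex^(2 + 2)"
  by (simp add: vec_eq_iff forall_2p2)

lemma bc_matrix_mult:
  "(M *v b) $ i = M $ i $ Inl 1 * b $ Inl 1 + M $ i $ Inl 2 * b $ Inl 2
     + M $ i $ Inr 1 * b $ Inr 1 + M $ i $ Inr 2 * b $ Inr 2"
  for M :: bc_matrix
  by (simp add: matrix_vector_mult_def sum_2p2)

text \<open>Parametrises the null space of \<open>(A, B)\<close>: the vector with blocks \<open>J A\<^sup>* c\<close> and \<open>- J B\<^sup>* c\<close>.\<close>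

definition lagrange_vector :: "bc_matrix \<Rightarrow> complex^2 \<Rightarrow> complex^(2 + 2)" where
  "lagrange_vector M c =
     (let v = conj_transpose M *v c in vec4 (v $ Inl 2) (- v $ Inl 1) (- v $ Inr 2) (v $ Inr 1))"

lemma conj_transpose_mult:
  "(conj_transpose M *v c) $ j = cnj (M $ 1 $ j) * c $ 1 + cnj (M $ 2 $ j) * c $ 2"
  for M :: bc_matrix
  by (simp add: matrix_vector_mult_def conj_transpose_def sum_2)

text \<open>The boundary term of Lagrange's identity: the bracket at 0 minus the bracket at
  N.\<close>

definition boundary_form :: "complex^(2 + 2) \<Rightarrow> complex^(2 + 2) \<Rightarrow> complex" where
  "boundary_form b b' = b $ Inl 1 * cnj (b' $ Inl 2) - b $ Inl 2 * cnj (b' $ Inl 1)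
     - (b $ Inr 1 * cnj (b' $ Inr 2) - b $ Inr 2 * cnj (b' $ Inr 1))"

text \<open>If \<open>M *v b = 0\<close> the form vanishes, which will give symmetry; conversely,
  vanishing for every \<open>c\<close> forces \<open>M *v b = 0\<close>, which will give
  maximality.\<close>

lemma boundary_form_lagrange_vector:
  "boundary_form b (lagrange_vector M c) = - (cnj (c $ 1) * (M *v b) $ 1 + cnj (c $ 2) * (M *v b) $ 2)"
  by (simp add: boundary_form_def lagrange_vector_def Let_def conj_transpose_mult bc_matrix_mult
      algebra_simps)

lemma self_adjoint_matrix_iff:
  "self_adjoint_matrix M \<longleftrightarrow>
     (\<forall>i k. M $ i $ Inl 1 * cnj (M $ k $ Inl 2) - M $ i $ Inl 2 * cnj (M $ k $ Inl 1)
          = M $ i $ Inr 1 * cnj (M $ k $ Inr 2) - M $ i $ Inr 2 * cnj (M $ k $ Inr 1))"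
  unfolding self_adjoint_matrix_def
  by (simp add: vec_eq_iff left_block_def right_block_def conj_transpose_def symplectic_J_def
      matrix_matrix_mult_def sum_2 forall_2 vector_2 algebra_simps)

lemma lagrange_vector_in_kernel:
  assumes "self_adjoint_matrix M"
  shows "M *v lagrange_vector M c = 0"
proof -
  have "M $ i $ Inl 1 * cnj (M $ k $ Inl 2) - M $ i $ Inl 2 * cnj (M $ k $ Inl 1)
          - (M $ i $ Inr 1 * cnj (M $ k $ Inr 2) - M $ i $ Inr 2 * cnj (M $ k $ Inr 1)) = 0" for i k
    using assms by (simp add: self_adjoint_matrix_iff)
  note * = this
  have "(M *v lagrange_vector M c) $ i = 0" for i
  proof -
    have "(M *v lagrange_vector M c) $ i =
        (M $ i $ Inl 1 * cnj (M $ 1 $ Inl 2) - M $ i $ Inl 2 * cnj (M $ 1 $ Inl 1)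
          - (M $ i $ Inr 1 * cnj (M $ 1 $ Inr 2) - M $ i $ Inr 2 * cnj (M $ 1 $ Inr 1))) * c $ 1 +
        (M $ i $ Inl 1 * cnj (M $ 2 $ Inl 2) - M $ i $ Inl 2 * cnj (M $ 2 $ Inl 1)
          - (M $ i $ Inr 1 * cnj (M $ 2 $ Inr 2) - M $ i $ Inr 2 * cnj (M $ 2 $ Inr 1))) * c $ 2"
      by (simp only: bc_matrix_mult lagrange_vector_def Let_def vec4_nth conj_transpose_mult)
        (simp add: algebra_simps)
    then show ?thesis by (simp add: *)
  qed
  then show ?thesis by (simp add: vec_eq_iff)
qed

text \<open>After conjugation, \<open>c\<close> is a linear relation between the rows of
  \<open>M\<close>, which rank 2 makes independent.\<close>

lemma conj_transpose_mult_eq_0: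
  fixes M :: bc_matrix
  assumes "rank M = 2" and "conj_transpose M *v c = 0"
  shows "c = 0"
proof -
  have fin: "finite (rows M)" by (simp add: rows_def full_SetCompr_eq)
  have rows: "rows M = {row 1 M, row 2 M}"
    by (auto simp: rows_def) (metis exhaust_2)
  have dim: "vec.dim (rows M) = 2" using assms(1) by (simp add: row_rank_def_gen)
  \<comment> \<open>\<open>rows M\<close> is a set, so equal rows would collapse to one element;
    distinctness lets one coefficient function on it carry both components of
    \<open>c\<close>.\<close>
  have ne: "row 1 M \<noteq> row 2 M"
  proof
    assume "row 1 M = row 2 M"
    then have "vec.dim (rows M) \<le> 1"
      using vec.dim_le_card'[OF fin] rows by auto
    with dim show False by simp
  qed
  have ind: "vec.independent (rows M)"
    using vec.card_le_dim_spanning[of "rows M" "rows M"] fin dim rows ne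
    by (auto intro: vec.card_le_dim_spanning simp: vec.span_superset)
  have z: "cnj (c $ 1) *s row 1 M + cnj (c $ 2) *s row 2 M = 0"
  proof -
    have "(conj_transpose M *v c) $ j = 0" for j using assms(2) by simp
    then have "cnj ((conj_transpose M *v c) $ j) = 0" for j by simp
    then show ?thesis
      by (simp add: conj_transpose_mult vec_eq_iff row_def mult.commute)
  qed
  have "\<forall>v\<in>rows M. (if v = row 1 M then cnj (c $ 1) else cnj (c $ 2)) = 0"
    using ind vec.dependent_finite[OF fin] z rows ne
    by (auto dest!: spec[where x="\<lambda>v. if v = row 1 M then cnj (c $ 1) else cnj (c $ 2)"])
  then show "c = 0"
    using rows not_sym[OF ne] by (simp add: vec_eq_iff[of c] forall_2)
qed

text \<open>C^4 is the sum of the range of M^* and the Lagrange vectors: the latter lie in the null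
  space, which the former meets only in 0. So \<open>F\<close>, from C^4 to itself, is injective and
  hence onto, and \<open>M *v b = 0\<close> removes the first summand of a preimage of
  \<open>b\<close>.\<close>

lemma kernel_eq_lagrange:
  fixes M :: bc_matrix
  assumes r: "rank M = 2" and sa: "self_adjoint_matrix M" and b: "M *v b = 0"
  obtains c where "b = lagrange_vector M c"
proof -
  define pr1 pr2 :: "complex^(2 + 2) \<Rightarrow> complex^2" where
    "pr1 = (\<lambda>v. \<chi> j. v $ Inl j)" and "pr2 = (\<lambda>v. \<chi> j. v $ Inr j)"
  define F where "F v = conj_transpose M *v pr1 v + lagrange_vector M (pr2 v)" for v
  have lin: "Vector_Spaces.linear (*s) (*s) F"
    by unfold_locales
      (auto simp: F_def pr1_def pr2_def lagrange_vector_def Let_def vec4_eq_iff conj_transpose_mult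
        algebra_simps)
  have key: "conj_transpose M *v c = 0" if "M *v (conj_transpose M *v c) = 0" for c
  proof -
    define v where "v = conj_transpose M *v c"
    \<comment> \<open>Only the conjugated factors are expanded, which yields |v|^2 = c^* M
      v.\<close>
    have "(\<Sum>j\<in>UNIV. v $ j * cnj (v $ j)) = cnj (c $ 1) * (M *v v) $ 1 + cnj (c $ 2) * (M *v v) $ 2"
      by (subst sum_2p2, subst (2 4 6 8) v_def)
         (simp add: conj_transpose_mult bc_matrix_mult algebra_simps)
    also have "\<dots> = 0" using that by (simp add: v_def)
    finally have "complex_of_real (\<Sum>j\<in>UNIV. (cmod (v $ j))\<^sup>2) = 0"
      by (simp add: complex_norm_square del: of_real_power)
    then have "(\<Sum>j\<in>UNIV. (cmod (v $ j))\<^sup>2) = 0" by (simp only: of_real_eq_0_iff)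
    then have "v $ j = 0" for j
      by (subst (asm) sum_nonneg_eq_0_iff) auto
    then show ?thesis by (simp add: v_def vec_eq_iff)
  qed
  have MF: "M *v F v = M *v (conj_transpose M *v pr1 v)" for v
    by (simp add: F_def matrix_vector_right_distrib lagrange_vector_in_kernel[OF sa])
  have "inj F"
  proof (subst vec.linear_inj_iff_eq_0[OF lin], intro allI impI)
    fix v assume 0: "F v = 0"
    then have 1: "conj_transpose M *v pr1 v = 0"
      using key MF[of v] by simp
    with 0 have "lagrange_vector M (pr2 v) = 0" by (simp add: F_def)
    then have 2: "conj_transpose M *v pr2 v = 0"
      by (simp add: lagrange_vector_def Let_def vec4_eq_iff)
    show "v = 0"
      using conj_transpose_mult_eq_0[OF r 1] conj_transpose_mult_eq_0[OF r 2]
      by (simp add: pr1_def pr2_def vec_eq_iff forall_2 forall_2p2)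
  qed
  then have "surj F" by (rule vec.linear_inj_imp_surj[OF lin])
  then obtain v where v: "b = F v" by (auto simp: surj_def)
  then have "conj_transpose M *v pr1 v = 0" using key MF b by simp
  then have "b = lagrange_vector M (pr2 v)" using v by (simp add: F_def)
  then show thesis by (rule that)
qed

section \<open>Regular problems and reduction to one representative\<close>

definition regular_slp :: "nat \<Rightarrow> sl_equation \<Rightarrow> bc_matrix \<Rightarrow> bool" where
  "regular_slp N \<omega> M \<longleftrightarrow> 2 \<le> N \<and> (\<forall>n\<in>{0..N}. fst \<omega> n \<noteq> 0) \<and> (\<forall>n\<in>{1..N}. sl_w \<omega> n > 0) \<and>
     rank M = 2 \<and> self_adjoint_matrix M"

lemma bc_class_self: "M \<in> bc_class M"
proof -
  have "invertible (mat 1 :: complex^2^2)"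
    unfolding invertible_def by (rule exI[of _ "mat 1"]) simp
  moreover have "M = mat 1 ** M" by simp
  ultimately show ?thesis unfolding bc_class_def by blast
qed

lemma solution_space_bc_class:
  assumes "regular_slp N \<omega> M"
  shows "solution_space N (\<omega>, bc_class M) lam =
    {y \<in> sl_domain N \<omega> M. \<forall>n\<in>{1..N}. sl_operator \<omega> y n = lam * y n}"
proof -
  have blocks: "left_block K *v boundary_values \<omega> y 0 + right_block K *v boundary_values \<omega> y N
      = K *v boundary_vector N \<omega> y" for K y
    by (simp add: vec_eq_iff bc_matrix_mult boundary_vector_def boundary_values_def left_block_def
        right_block_def matrix_vector_mult_def sum_2 sum_2p2 vector_2)
  have "satisfies_bc N \<omega> (bc_class M) y \<longleftrightarrow> M *v boundary_vector N \<omega> y = 0" for y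
  proof
    assume s: "satisfies_bc N \<omega> (bc_class M) y"
    show "M *v boundary_vector N \<omega> y = 0"
      using s bc_class_self by (auto simp: satisfies_bc_def blocks)
  next
    assume "M *v boundary_vector N \<omega> y = 0"
    then show "satisfies_bc N \<omega> (bc_class M) y"
      by (auto simp: satisfies_bc_def blocks bc_class_def simp flip: matrix_vector_mul_assoc)
  qed
  moreover have "solves_equation N \<omega> lam y \<longleftrightarrow> (\<forall>n\<in>{1..N}. sl_operator \<omega> y n = lam * y n)" for y
    unfolding solves_equation_def sl_operator_def
  proof (intro ball_cong refl)
    fix n assume "n \<in> {1..N}"
    then have "sl_w \<omega> n > 0" using assms unfolding regular_slp_def by blast
    then show "(- bwd_diff (quasi_diff \<omega> y) n + complex_of_real (sl_q \<omega> n) * y n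
          = lam * complex_of_real (sl_w \<omega> n) * y n) \<longleftrightarrow>
        ((- bwd_diff (quasi_diff \<omega> y) n + complex_of_real (sl_q \<omega> n) * y n) / complex_of_real (sl_w \<omega> n)
          = lam * y n)"
      by (simp add: divide_eq_eq mult_ac)
  qed
  ultimately show ?thesis by (auto simp: solution_space_def sl_domain_def)
qed

section \<open>The symmetric operator\<close>

text \<open>As N >= 2, the indices 0, 1, N, N + 1 are distinct, so every boundary vector is
  attained. The entries at 1 and N + 1 use 1/f as a factor and thus depend continuously on the
  problem.\<close>

definition with_boundary ::
    "nat \<Rightarrow> sl_equation \<Rightarrow> complex^(2 + 2) \<Rightarrow> (nat \<Rightarrow> complex) \<Rightarrow> nat \<Rightarrow> complex" where
  "with_boundary N \<omega> b a n =
    (if n = 0 then b $ Inl 1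
     else if n = 1 then b $ Inl 1 + complex_of_real (fst \<omega> 0) * b $ Inl 2
     else if n = N then b $ Inr 1
     else if n = N + 1 then b $ Inr 1 + complex_of_real (fst \<omega> N) * b $ Inr 2
     else if n < N then a n else 0)"

locale regular_sl =
  fixes N :: nat and \<omega> :: sl_equation and M :: bc_matrix
  assumes regular: "regular_slp N \<omega> M"
begin

abbreviation ip where "ip \<equiv> sl_inner N \<omega>"
abbreviation op where "op \<equiv> sl_operator \<omega>"
abbreviation dom where "dom \<equiv> sl_domain N \<omega> M"

lemma N_ge_2: "2 \<le> N"
  and g_nz: "n \<le> N \<Longrightarrow> fst \<omega> n \<noteq> 0"
  and w_pos: "1 \<le> n \<Longrightarrow> n \<le> N \<Longrightarrow> sl_w \<omega> n > 0"
  and rank_2: "rank M = 2"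
  and sa: "self_adjoint_matrix M"
  using regular by (auto simp: regular_slp_def)

section \<open>The weighted inner product and the domain\<close>

lemma ip_cong:
  assumes "\<And>n. 1 \<le> n \<Longrightarrow> n \<le> N \<Longrightarrow> x n = x' n" "\<And>n. 1 \<le> n \<Longrightarrow> n \<le> N \<Longrightarrow> y n = y' n"
  shows "ip x y = ip x' y'"
  unfolding sl_inner_def by (intro sum.cong refl) (auto simp: assms)

lemma ip_add_left: "ip (\<lambda>n. x n + c * y n) z = ip x z + c * ip y z"
  by (simp add: sl_inner_def algebra_simps sum.distrib sum_distrib_left)

lemma ip_add_right: "ip z (\<lambda>n. x n + c * y n) = ip z x + cnj c * ip z y"
  by (simp add: sl_inner_def algebra_simps sum.distrib sum_distrib_left)

lemma ip_scale_left: "ip (\<lambda>n. c * y n) z = c * ip y z"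
  by (simp add: sl_inner_def algebra_simps sum_distrib_left)

lemma ip_scale_right: "ip z (\<lambda>n. c * y n) = cnj c * ip z y"
  by (simp add: sl_inner_def algebra_simps sum_distrib_left)

lemma ip_sum_left: "ip (\<lambda>n. \<Sum>i\<in>I. \<alpha> i * x i n) z = (\<Sum>i\<in>I. \<alpha> i * ip (x i) z)"
  unfolding sl_inner_def sum_distrib_left sum_distrib_right
  by (subst sum.swap) (simp add: mult_ac)

lemma ip_sum_right: "ip z (\<lambda>n. \<Sum>i\<in>I. \<alpha> i * x i n) = (\<Sum>i\<in>I. cnj (\<alpha> i) * ip z (x i))"
  unfolding sl_inner_def sum_distrib_left sum_distrib_right cnj_sum
  by (subst sum.swap) (simp add: mult_ac)

lemma cnj_ip: "cnj (ip x y) = ip y x"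
  by (simp add: sl_inner_def mult_ac)

lemma ip_self: "ip x x = complex_of_real (\<Sum>n=1..N. sl_w \<omega> n * (cmod (x n))\<^sup>2)"
  unfolding sl_inner_def of_real_sum
  by (intro sum.cong refl) (simp add: complex_norm_square mult.assoc del: of_real_power)

lemma Re_ip_self: "Re (ip x x) = (\<Sum>n=1..N. sl_w \<omega> n * (cmod (x n))\<^sup>2)"
  by (simp add: ip_self)

lemma ip_self_of_real: "ip x x = complex_of_real (Re (ip x x))"
  by (simp add: ip_self)

lemma ip_self_nonneg: "0 \<le> Re (ip x x)"
  unfolding Re_ip_self by (intro sum_nonneg mult_nonneg_nonneg) (auto intro: less_imp_le[OF w_pos])

lemma ip_self_ge:
  assumes "1 \<le> n" "n \<le> N"
  shows "sl_w \<omega> n * (cmod (x n))\<^sup>2 \<le> Re (ip x x)"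
  unfolding Re_ip_self
  by (rule member_le_sum[where f="\<lambda>n. sl_w \<omega> n * (cmod (x n))\<^sup>2"])
    (use assms in \<open>auto simp: w_pos less_imp_le\<close>)

lemma ip_self_eq_0:
  assumes "Re (ip x x) = 0" "1 \<le> n" "n \<le> N"
  shows "x n = 0"
  using ip_self_ge[OF assms(2,3), of x] w_pos[OF assms(2,3)] assms(1)
  by (simp add: mult_le_0_iff)

lemma op_add: "op (\<lambda>n. x n + c * y n) n = op x n + c * op y n"
  by (simp add: sl_operator_def bwd_diff_def quasi_diff_def fwd_diff_def add_divide_distrib
      diff_divide_distrib algebra_simps)

lemma op_sum: "op (\<lambda>n. \<Sum>i\<in>I. \<alpha> i * x i n) n = (\<Sum>i\<in>I. \<alpha> i * op (x i) n)"
proof (cases "finite I")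
  case True
  then show ?thesis
  proof (induction I)
    case empty
    show ?case by (simp add: sl_operator_def bwd_diff_def quasi_diff_def fwd_diff_def)
  next
    case (insert i I)
    then show ?case
      using op_add[of "\<lambda>n. \<Sum>i\<in>I. \<alpha> i * x i n" "\<alpha> i" "x i" n] by (simp add: add.commute)
  qed
qed (simp add: sl_operator_def bwd_diff_def quasi_diff_def fwd_diff_def)

lemma dom_0: "(\<lambda>_. 0) \<in> dom"
  by (simp add: sl_domain_def vec_eq_iff bc_matrix_mult boundary_vector_def quasi_diff_def fwd_diff_def)

lemma dom_add:
  assumes "x \<in> dom" "y \<in> dom"
  shows "(\<lambda>n. x n + c * y n) \<in> dom"
proof -
  have "boundary_vector N \<omega> (\<lambda>n. x n + c * y n) = boundary_vector N \<omega> x + c *s boundary_vector N \<omega> y"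
    by (simp add: boundary_vector_def vec4_eq_iff quasi_diff_def fwd_diff_def algebra_simps)
  then show ?thesis
    using assms
    by (simp add: sl_domain_def matrix_vector_right_distrib matrix_vector_mult_scaleR vec.scale
        vector_scalar_commute)
qed

lemma dom_sum:
  assumes "\<And>i. i \<in> I \<Longrightarrow> x i \<in> dom"
  shows "(\<lambda>n. \<Sum>i\<in>I. \<alpha> i * x i n) \<in> dom"
proof (cases "finite I")
  case True
  then show ?thesis using assms
  proof (induction I)
    case empty
    show ?case using dom_0 by simp
  next
    case (insert i I)
    then show ?case
      using dom_add[of "\<lambda>n. \<Sum>i\<in>I. \<alpha> i * x i n" "x i" "\<alpha> i"] by (simp add: add.commute)
  qed
qed (use dom_0 in simp)

lemma w_op: "1 \<le> n \<Longrightarrow> n \<le> N \<Longrightarrow>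
    complex_of_real (sl_w \<omega> n) * op y n = - bwd_diff (quasi_diff \<omega> y) n + complex_of_real (sl_q \<omega> n) * y n"
  using w_pos[of n] by (simp add: sl_operator_def)

lemma quasi_diff_eq: "n \<le> N \<Longrightarrow> y (Suc n) = y n + complex_of_real (fst \<omega> n) * quasi_diff \<omega> y n"
  using g_nz[of n] by (simp add: quasi_diff_def fwd_diff_def sl_f_def)

text \<open>The equation at n = 1 solved for \<open>y 0\<close>; \<open>last_eq\<close> does the
  same at N for \<open>y (N + 1)\<close>. Hence y and l y on 1..N together determine the whole
  sequence.\<close>

lemma first_eq:
  "y 0 = y 1 - complex_of_real (fst \<omega> 0) *
     (complex_of_real (sl_w \<omega> 1) * op y 1 + quasi_diff \<omega> y 1 - complex_of_real (sl_q \<omega> 1) * y 1)"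
  using w_op[of 1 y] quasi_diff_eq[of 0 y] N_ge_2 by (simp add: bwd_diff_def)

lemma last_eq:
  "y (N + 1) = y N + complex_of_real (fst \<omega> N) *
     (quasi_diff \<omega> y (N - 1) + complex_of_real (sl_q \<omega> N) * y N - complex_of_real (sl_w \<omega> N) * op y N)"
  using w_op[of N y] quasi_diff_eq[of N y] N_ge_2 by (simp add: bwd_diff_def)

lemma dom_eq_0I:
  assumes "y \<in> dom" "\<And>n. 1 \<le> n \<Longrightarrow> n \<le> N \<Longrightarrow> y n = 0" "\<And>n. 1 \<le> n \<Longrightarrow> n \<le> N \<Longrightarrow> op y n = 0"
  shows "y = (\<lambda>_. 0)"
proof
  fix n
  have "y 0 = 0"
    using first_eq[of y] assms(2,3) N_ge_2 by (simp add: quasi_diff_def fwd_diff_def)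
  moreover have "y (N + 1) = 0"
    using last_eq[of y] assms(2,3) N_ge_2 by (simp add: quasi_diff_def fwd_diff_def)
  moreover have "y n = 0" if "n > N + 1" using that assms(1) by (simp add: sl_domain_def)
  ultimately show "y n = 0"
    using assms(2)[of n] by (cases "n = 0"; cases "n \<le> N"; cases "n = N + 1") auto
qed

text \<open>Lagrange's identity: the sum telescopes to the difference of two Casoratians.\<close>

lemma green: "ip (op y) z - ip y (op z) = - boundary_form (boundary_vector N \<omega> y) (boundary_vector N \<omega> z)"
proof -
  define W where "W n = y n * cnj (quasi_diff \<omega> z n) - quasi_diff \<omega> y n * cnj (z n)" for n
  have step: "complex_of_real (sl_w \<omega> n) * op y n * cnj (z n) - complex_of_real (sl_w \<omega> n) * y n * cnj (op z n)
      = W n - W (n - 1)" if n: "1 \<le> n" "n \<le> N" for n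
  proof -
    obtain k where k: "n = Suc k" using n by (cases n) auto
    have 1: "complex_of_real (sl_w \<omega> n) * op y n * cnj (z n) - complex_of_real (sl_w \<omega> n) * y n * cnj (op z n)
       = (complex_of_real (sl_w \<omega> n) * op y n) * cnj (z n) - y n * cnj (complex_of_real (sl_w \<omega> n) * op z n)"
      by simp
    have yn: "y k = y n - complex_of_real (fst \<omega> k) * quasi_diff \<omega> y k"
      "z k = z n - complex_of_real (fst \<omega> k) * quasi_diff \<omega> z k"
      using quasi_diff_eq[of k y] quasi_diff_eq[of k z] n k by simp_all
    show ?thesis
      unfolding 1 unfolding w_op[OF n] W_def bwd_diff_def
      by (simp add: k) (simp add: yn k algebra_simps)
  qed
  have "ip (op y) z - ip y (op z) = (\<Sum>n=1..N. W n - W (n - 1))"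
    unfolding sl_inner_def sum_subtractf[symmetric]
    by (intro sum.cong refl) (use step in auto)
  also have "\<dots> = (\<Sum>n=Suc 0..N. W n - W (n - 1))" by simp
  also have "\<dots> = W N - W 0"
    by (rule sum_telescope'') simp
  finally show ?thesis
    by (simp add: W_def boundary_form_def boundary_vector_def)
qed

lemma op_symmetric:
  assumes "y \<in> dom" "z \<in> dom"
  shows "ip (op y) z = ip y (op z)"
proof -
  obtain c where "boundary_vector N \<omega> z = lagrange_vector M c"
    using kernel_eq_lagrange[OF rank_2 sa, of "boundary_vector N \<omega> z"] assms(2)
    by (auto simp: sl_domain_def)
  then show ?thesis
    using green[of y z] assms(1) by (simp add: boundary_form_lagrange_vector sl_domain_def)
qed

lemma boundary_vector_with_boundary: "boundary_vector N \<omega> (with_boundary N \<omega> b a) = b"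
  using N_ge_2 g_nz[of 0] g_nz[of N]
  by (auto simp: boundary_vector_def vec4_eq_iff with_boundary_def quasi_diff_def fwd_diff_def sl_f_def)

lemma with_boundary_in_dom: "M *v b = 0 \<Longrightarrow> with_boundary N \<omega> b a \<in> dom"
  using N_ge_2 by (simp add: sl_domain_def boundary_vector_with_boundary) (simp add: with_boundary_def)

text \<open>The step from symmetry to self-adjointness: a pair in the adjoint relation already
  belongs to the relation. As \<open>a\<close> and \<open>b\<close> matter only on 1..N, the values
  of \<open>t\<close> at 0 and N + 1 have to be constructed.\<close>

lemma op_maximal:
  assumes ab: "\<And>z. z \<in> dom \<Longrightarrow> ip a (op z) = ip b z"
  shows "\<exists>t\<in>dom. \<forall>n\<in>{1..N}. t n = a n \<and> op t n = b n"
proof -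
  define qa where "qa n = complex_of_real (sl_f \<omega> n) * (a (n + 1) - a n)" for n
  \<comment> \<open>The outer values are those that \<open>first_eq\<close> and
    \<open>last_eq\<close> force if \<open>op t\<close> is to equal \<open>b\<close> at 1 and
    N.\<close>
  define t where "t n =
    (if n = 0 then a 1 - complex_of_real (fst \<omega> 0) *
       (complex_of_real (sl_w \<omega> 1) * b 1 + qa 1 - complex_of_real (sl_q \<omega> 1) * a 1)
     else if n \<le> N then a n
     else if n = N + 1 then a N + complex_of_real (fst \<omega> N) *
       (qa (N - 1) + complex_of_real (sl_q \<omega> N) * a N - complex_of_real (sl_w \<omega> N) * b N)
     else 0)" for n
  have ta: "t n = a n" if "1 \<le> n" "n \<le> N" for n using that by (simp add: t_def)
  have qt: "quasi_diff \<omega> t n = qa n" if "1 \<le> n" "n < N" for n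
    using that by (simp add: quasi_diff_def fwd_diff_def qa_def ta)
  have t1: "op t 1 = b 1"
  proof -
    have "complex_of_real (fst \<omega> 0) * (complex_of_real (sl_w \<omega> 1) * op t 1) =
        complex_of_real (fst \<omega> 0) * (complex_of_real (sl_w \<omega> 1) * b 1)"
      using first_eq[of t] qt[of 1] N_ge_2 ta[of 1]
      by (simp add: t_def[of 0] algebra_simps)
    then show ?thesis using g_nz[of 0] w_pos[of 1] N_ge_2 by simp
  qed
  have tN: "op t N = b N"
  proof -
    have "complex_of_real (fst \<omega> N) * (complex_of_real (sl_w \<omega> N) * op t N) =
        complex_of_real (fst \<omega> N) * (complex_of_real (sl_w \<omega> N) * b N)"
      using last_eq[of t] qt[of "N - 1"] N_ge_2 ta[of N]
      by (simp add: t_def[of "N + 1"] t_def[of "Suc N"] algebra_simps)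
    then show ?thesis using g_nz[of N] w_pos[of N] N_ge_2 by simp
  qed
  have pair: "ip (\<lambda>n. op t n + (- 1) * b n) z = - boundary_form (boundary_vector N \<omega> t) (boundary_vector N \<omega> z)"
    if "z \<in> dom" for z
  proof -
    have "ip t (op z) = ip a (op z)" by (rule ip_cong) (auto simp: ta)
    then show ?thesis
      using green[of t z] ab[OF that] by (simp only: ip_add_left) simp
  qed
  have tn: "op t n = b n" if n: "1 < n" "n < N" for n
  proof -
    \<comment> \<open>A unit sequence at an interior index has boundary vector 0, so it lies in the
      domain and isolates one coordinate.\<close>
    define z where "z = with_boundary N \<omega> 0 (\<lambda>j. if j = n then 1 else 0)"
    have "z \<in> dom" unfolding z_def by (rule with_boundary_in_dom) simp
    then have "ip (\<lambda>n. op t n + (- 1) * b n) z = 0"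
      using pair by (simp add: z_def boundary_vector_with_boundary boundary_form_def)
    moreover have "ip (\<lambda>n. op t n + (- 1) * b n) z = (\<Sum>j=1..N. if j = n then complex_of_real (sl_w \<omega> n) * (op t n - b n) else 0)"
      unfolding sl_inner_def using n
      by (intro sum.cong refl) (auto simp: z_def with_boundary_def)
    ultimately show ?thesis using n w_pos[of n] by simp
  qed
  have all: "op t n = b n" if "1 \<le> n" "n \<le> N" for n
    using that t1 tN tn by (cases "n = 1"; cases "n = N") auto
  have "boundary_form (boundary_vector N \<omega> t) (lagrange_vector M c) = 0" for c
  proof -
    \<comment> \<open>Every Lagrange vector is the boundary vector of some \<open>z\<close> in the
      domain; as \<open>op t\<close> now equals \<open>b\<close>, Green's identity leaves only the
      boundary form.\<close>
    define z where "z = with_boundary N \<omega> (lagrange_vector M c) (\<lambda>_. 0)"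
    have "z \<in> dom" unfolding z_def by (rule with_boundary_in_dom) (rule lagrange_vector_in_kernel[OF sa])
    moreover have "ip (\<lambda>n. op t n + (- 1) * b n) z = 0"
      unfolding sl_inner_def by (intro sum.neutral) (auto simp: all)
    ultimately show ?thesis using pair by (simp add: z_def boundary_vector_with_boundary)
  qed
  note * = this[unfolded boundary_form_lagrange_vector]
  have "(M *v boundary_vector N \<omega> t) $ 1 = 0" "(M *v boundary_vector N \<omega> t) $ 2 = 0"
    using *[of "axis 1 1"] *[of "axis 2 1"] by (simp_all add: axis_def)
  then have "M *v boundary_vector N \<omega> t = 0" by (simp add: vec_eq_iff forall_2)
  then have "t \<in> dom" by (simp add: sl_domain_def t_def)
  then show ?thesis using ta all by (intro bexI[of _ t]) auto
qed

end

section \<open>Completeness of the eigenfunctions\<close>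

text \<open>Sequences are functions on all naturals with the product topology, so this is
  Tychonoff's theorem.\<close>

lemma compact_coordinate_box: "compact {y :: nat \<Rightarrow> complex. \<forall>n. cmod (y n) \<le> b n}"
proof -
  have "compactin (product_topology (\<lambda>_. euclidean) UNIV) (PiE UNIV (\<lambda>n. cball (0::complex) (b n)))"
    by (simp add: compactin_PiE)
  moreover have "PiE UNIV (\<lambda>n. cball (0::complex) (b n)) = {y. \<forall>n. cmod (y n) \<le> b n}"
    by (auto simp: PiE_UNIV_domain)
  ultimately show ?thesis
    by (simp add: euclidean_product_topology flip: compactin_euclidean_iff)
qed

text \<open>The first-order condition at a minimum. With s > |b|, the value at t = - a / s is (a /
  s)^2 (b - 2 s), which is negative unless a = 0.\<close>

lemma linear_coeff_eq_0:
  fixes a b :: real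
  assumes "\<And>t. 2 * t * a + t\<^sup>2 * b \<ge> 0"
  shows "a = 0"
proof (rule ccontr)
  assume "a \<noteq> 0"
  define s where "s = \<bar>b\<bar> + 1"
  have s: "s > 0" "b < 2 * s" by (auto simp: s_def)
  define t where "t = - a / s"
  have "2 * t * a + t\<^sup>2 * b = (a\<^sup>2 / s\<^sup>2) * (b - 2 * s)"
    using s(1) by (simp add: t_def field_simps power2_eq_square)
  also have "\<dots> < 0"
    using \<open>a \<noteq> 0\<close> s by (intro mult_pos_neg divide_pos_pos) auto
  finally show False using assms[of t] by simp
qed

context regular_sl
begin

lemma continuous_on_op: "continuous_on S (\<lambda>y. op y n)"
  unfolding sl_operator_def bwd_diff_def quasi_diff_def fwd_diff_def
  by (cases "sl_w \<omega> n = 0")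
    (auto intro!: continuous_intros continuous_on_subset[OF continuous_on_product_coordinates])

lemma continuous_on_ip:
  assumes "\<And>n. continuous_on S (\<lambda>y. f y n)" "\<And>n. continuous_on S (\<lambda>y. h y n)"
  shows "continuous_on S (\<lambda>y. ip (f y) (h y))"
  unfolding sl_inner_def by (intro continuous_intros assms)

text \<open>The weights bound y and l y on 1..N, and \<open>first_eq\<close> and
  \<open>last_eq\<close> then bound y at 0 and N + 1. The norm of y alone would not do this for a
  multivalued relation.\<close>

lemma coordinates_bounded:
  obtains b where
    "\<And>y n. y \<in> dom \<Longrightarrow> Re (ip y y) \<le> 1 \<Longrightarrow> Re (ip (op y) (op y)) \<le> 1 \<Longrightarrow> cmod (y n) \<le> b n"
proof -
  define \<beta> where "\<beta> n = sqrt (1 / sl_w \<omega> n)" for n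
  have in_range: "cmod (x n) \<le> \<beta> n" if "Re (ip x x) \<le> 1" "1 \<le> n" "n \<le> N" for x n
  proof -
    have "(cmod (x n))\<^sup>2 \<le> 1 / sl_w \<omega> n"
      using ip_self_ge[of n x] that w_pos[of n] by (simp add: field_simps)
    then show ?thesis unfolding \<beta>_def by (rule real_le_rsqrt)
  qed
  define \<gamma> where "\<gamma> n = \<bar>sl_f \<omega> n\<bar> * (\<beta> (Suc n) + \<beta> n)" for n
  have quasi: "cmod (quasi_diff \<omega> y n) \<le> \<gamma> n" if "Re (ip y y) \<le> 1" "1 \<le> n" "n < N" for y n
  proof -
    have "cmod (fwd_diff y n) \<le> \<beta> (Suc n) + \<beta> n"
      using in_range[OF that(1), of n] in_range[OF that(1), of "Suc n"] that(2,3)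
        norm_triangle_ineq4[of "y (Suc n)" "y n"]
      by (simp add: fwd_diff_def)
    then show ?thesis
      by (simp add: quasi_diff_def \<gamma>_def norm_mult mult_left_mono)
  qed
  define b where "b n =
    (if n = 0 then \<beta> 1 + \<bar>fst \<omega> 0\<bar> * (\<bar>sl_w \<omega> 1\<bar> * \<beta> 1 + \<gamma> 1 + \<bar>sl_q \<omega> 1\<bar> * \<beta> 1)
     else if n \<le> N then \<beta> n
     else if n = N + 1 then
       \<beta> N + \<bar>fst \<omega> N\<bar> * (\<gamma> (N - 1) + \<bar>sl_q \<omega> N\<bar> * \<beta> N + \<bar>sl_w \<omega> N\<bar> * \<beta> N)
     else 0)" for n
  have "cmod (y n) \<le> b n" if y: "y \<in> dom" and 1: "Re (ip y y) \<le> 1" and 2: "Re (ip (op y) (op y)) \<le> 1"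
    for y n
  proof -
    \<comment> \<open>Shaped after \<open>first_eq\<close>; moving a sign brings
      \<open>last_eq\<close> to the same form.\<close>
    have tri: "cmod (a - c * (u * d + e - v * a')) \<le> A + \<bar>r\<bar> * (U * D + E + V * A')"
      if "cmod a \<le> A" "cmod c = \<bar>r\<bar>" "cmod u = U" "cmod d \<le> D" "cmod e \<le> E" "cmod v = V" "cmod a' \<le> A'"
      for a c u d e v a' :: complex and A r U D E V A'
    proof -
      have "cmod (u * d + e - v * a') \<le> cmod u * cmod d + cmod e + cmod v * cmod a'"
        using norm_triangle_ineq4[of "u * d + e" "v * a'"] norm_triangle_ineq[of "u * d" e]
        by (simp add: norm_mult)
      also have "\<dots> \<le> U * D + E + V * A'"
        using that by (intro add_mono mult_mono) auto
      finally have "cmod (c * (u * d + e - v * a')) \<le> \<bar>r\<bar> * (U * D + E + V * A')"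
        using that(2) by (simp add: norm_mult mult_left_mono)
      then show ?thesis
        using norm_triangle_ineq4[of a "c * (u * d + e - v * a')"] that(1) by linarith
    qed
    consider "n = 0" | "1 \<le> n" "n \<le> N" | "n = N + 1" | "n > N + 1" by linarith
    then show ?thesis
    proof cases
      case 1
      show ?thesis
        unfolding 1 first_eq[of y] b_def if_P[OF refl]
        by (rule tri) (use in_range[OF that(2)] in_range[OF that(3)] quasi[OF that(2)] N_ge_2 in auto)
    next
      case 2
      then show ?thesis using in_range[OF 1] by (simp add: b_def)
    next
      case 3
      have e: "y (N + 1) = y N - complex_of_real (fst \<omega> N) *
          (complex_of_real (sl_w \<omega> N) * op y N + (- quasi_diff \<omega> y (N - 1)) - complex_of_real (sl_q \<omega> N) * y N)"
        using last_eq[of y] by (simp add: algebra_simps)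
      have "cmod (y (N + 1)) \<le> \<beta> N + \<bar>fst \<omega> N\<bar> * (\<bar>sl_w \<omega> N\<bar> * \<beta> N + \<gamma> (N - 1) + \<bar>sl_q \<omega> N\<bar> * \<beta> N)"
        unfolding e
        by (rule tri) (use in_range[OF that(2)] in_range[OF that(3)] quasi[OF that(2), of "N - 1"] N_ge_2 in auto)
      then show ?thesis unfolding 3 by (simp add: b_def add_ac)
    next
      case 4
      then show ?thesis using y N_ge_2 by (simp add: b_def sl_domain_def)
    qed
  qed
  then show thesis by (rule that)
qed

end

text \<open>\<open>no_more\<close> states only maximality among eigenfunctions; that the family
  spans the domain up to sequences vanishing on 1..N is proved in \<open>complete\<close>. Both the
  limit problem and its neighbours are instances.\<close>

locale sl_eigenbasis = regular_sl +
  fixes k :: nat and e :: "nat \<Rightarrow> nat \<Rightarrow> complex" and \<mu> :: "nat \<Rightarrow> real"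
  assumes e_dom: "j < k \<Longrightarrow> e j \<in> dom"
    and op_e: "j < k \<Longrightarrow> 1 \<le> n \<Longrightarrow> n \<le> N \<Longrightarrow> op (e j) n = complex_of_real (\<mu> j) * e j n"
    and orthonormal: "i < k \<Longrightarrow> j < k \<Longrightarrow> ip (e i) (e j) = (if i = j then 1 else 0)"
    and no_more: "y \<in> dom \<Longrightarrow> (\<And>n. 1 \<le> n \<Longrightarrow> n \<le> N \<Longrightarrow> op y n = complex_of_real lam * y n) \<Longrightarrow>
      (\<And>j. j < k \<Longrightarrow> ip y (e j) = 0) \<Longrightarrow> y = (\<lambda>_. 0)"
begin

lemma ip_op_e_right: "j < k \<Longrightarrow> ip x (op (e j)) = complex_of_real (\<mu> j) * ip x (e j)"
proof -
  assume j: "j < k"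
  have "ip x (op (e j)) = ip x (\<lambda>n. complex_of_real (\<mu> j) * e j n)"
    by (rule ip_cong) (use op_e[OF j] in auto)
  then show ?thesis by (simp add: ip_scale_right)
qed

lemma ip_op_e: "j < k \<Longrightarrow> y \<in> dom \<Longrightarrow> ip (op y) (e j) = complex_of_real (\<mu> j) * ip y (e j)"
  using op_symmetric[OF _ e_dom] ip_op_e_right by simp

text \<open>The factor \<open>(- 1)\<close> brings the subtraction into the shape x + c y of the
  linearity lemmas.\<close>

definition rest :: "(nat \<Rightarrow> complex) \<Rightarrow> nat \<Rightarrow> complex" where
  "rest y n = y n + (- 1) * (\<Sum>j<k. ip y (e j) * e j n)"

lemma rest_dom: "y \<in> dom \<Longrightarrow> rest y \<in> dom"
  unfolding rest_def by (intro dom_add dom_sum) (auto intro: e_dom)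

lemma rest_orthogonal:
  assumes "i < k"
  shows "ip (rest y) (e i) = 0"
proof -
  have "ip (rest y) (e i) = ip y (e i) + (- 1) * (\<Sum>j<k. ip y (e j) * ip (e j) (e i))"
    unfolding rest_def by (simp only: ip_add_left ip_sum_left)
  also have "(\<Sum>j<k. ip y (e j) * ip (e j) (e i)) = (\<Sum>j<k. if j = i then ip y (e i) else 0)"
    using assms by (intro sum.cong refl) (auto simp: orthonormal)
  finally show ?thesis using assms by simp
qed

lemma op_rest: "op (rest y) n = op y n + (- 1) * (\<Sum>j<k. ip y (e j) * op (e j) n)"
  unfolding rest_def by (simp only: op_add op_sum)

text \<open>If the orthogonal complement of the family in the domain were not contained in the
  multivalued part, then maximising \<open>\<langle>y, y\<rangle> / (\<langle>y, y\<rangle> + \<langle>l y, l y\<rangle>)\<close> over it would produce a \<open>y\<close> with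
  \<open>l\<^sup>2 y = \<nu>\<^sup>2 y\<close>, and one of \<open>l y \<plusminus> \<nu> y\<close> would be a new eigenfunction.\<close>

lemma complete:
  assumes y: "y \<in> dom" and orth: "\<And>j. j < k \<Longrightarrow> ip y (e j) = 0" and n: "1 \<le> n" "n \<le> N"
  shows "y n = 0"
proof (rule ccontr)
  assume yn: "y n \<noteq> 0"
  define V where "V = {y \<in> dom. \<forall>j<k. ip y (e j) = 0}"
  \<comment> \<open>The squared graph norm. Its unit sphere \<open>K\<close> in \<open>V\<close> is
    compact, whereas the sphere of \<open>ip y y\<close> is unbounded when the relation is
    multivalued.\<close>
  define q where "q y = Re (ip y y) + Re (ip (op y) (op y))" for y
  define K where "K = {y \<in> V. q y = 1}"
  have V_add: "(\<lambda>n. x n + c * z n) \<in> V" if "x \<in> V" "z \<in> V" for x z c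
    using that by (auto simp: V_def dom_add ip_add_left)
  have V_scale: "(\<lambda>n. c * z n) \<in> V" if "z \<in> V" for z c
    using V_add[OF _ that, of "\<lambda>_. 0" c] dom_0 by (simp add: V_def sl_inner_def)
  have op_scale: "op (\<lambda>n. c * z n) = (\<lambda>n. c * op z n)" for c z
    using op_add[of "\<lambda>_. 0" c z] by (simp add: fun_eq_iff sl_operator_def bwd_diff_def quasi_diff_def fwd_diff_def)
  have q_scale: "q (\<lambda>n. c * z n) = (cmod c)\<^sup>2 * q z" for c z
  proof -
    have "ip (\<lambda>n. c * x n) (\<lambda>n. c * x n) = complex_of_real ((cmod c)\<^sup>2) * ip x x" for x
      by (simp add: ip_scale_left ip_scale_right complex_norm_square del: of_real_power)
    then show ?thesis
      by (simp add: q_def op_scale algebra_simps del: of_real_power)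
  qed
  have q_nonneg: "0 \<le> q z" for z
    by (simp add: q_def ip_self_nonneg)
  obtain b where b: "\<And>y n. y \<in> dom \<Longrightarrow> Re (ip y y) \<le> 1 \<Longrightarrow> Re (ip (op y) (op y)) \<le> 1 \<Longrightarrow> cmod (y n) \<le> b n"
    by (rule coordinates_bounded) blast
  have coord: "continuous_on UNIV (\<lambda>y :: nat \<Rightarrow> complex. y n)" for n
    by (rule continuous_on_product_coordinates)
  have cont_g: "continuous_on UNIV (\<lambda>y. ip y (e j))" for j
    by (intro continuous_on_ip coord continuous_on_const)
  have cont_n: "continuous_on UNIV (\<lambda>y. Re (ip y y))"
    by (intro continuous_on_Re continuous_on_ip coord)
  have cont_q: "continuous_on UNIV q"
    unfolding q_def by (intro continuous_on_add cont_n continuous_on_Re continuous_on_ip continuous_on_op)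
  have cont_b: "continuous_on UNIV (\<lambda>y. (M *v boundary_vector N \<omega> y) $ i)" for i
    unfolding bc_matrix_mult boundary_vector_def vec4_nth quasi_diff_def fwd_diff_def
    by (intro continuous_intros coord)
  have K_eq: "K = {y. \<forall>n. cmod (y n) \<le> b n} \<inter>
     ((\<Inter>n\<in>{N+1<..}. {y. y n = 0}) \<inter> (\<Inter>i. {y. (M *v boundary_vector N \<omega> y) $ i = 0}) \<inter>
      (\<Inter>j\<in>{..<k}. {y. ip y (e j) = 0}) \<inter> {y. q y = 1})"
  proof -
    have "cmod (z n) \<le> b n" if "z \<in> K" for z n
      using that b[of z n] ip_self_nonneg[of z] ip_self_nonneg[of "op z"] by (auto simp: K_def V_def q_def)
    then show ?thesis
      by (auto simp: K_def V_def sl_domain_def vec_eq_iff)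
  qed
  have "compact K"
    unfolding K_eq
    by (intro compact_Int_closed compact_coordinate_box closed_Int closed_INT ballI
        closed_Collect_eq cont_q cont_b cont_g coord continuous_on_const)
  have qy: "q y > 0"
    using ip_self_eq_0[of y n] n yn q_nonneg[of y] ip_self_nonneg[of y] ip_self_nonneg[of "op y"]
    by (fastforce simp: q_def)
  have "y \<in> V" using y orth by (simp add: V_def)
  then have "(\<lambda>n. complex_of_real (1 / sqrt (q y)) * y n) \<in> K"
    using qy V_scale by (simp only: K_def q_scale mem_Collect_eq) (simp add: power_divide norm_divide)
  then have "K \<noteq> {}" by blast
  obtain u where u: "u \<in> K" and max: "\<And>z. z \<in> K \<Longrightarrow> Re (ip z z) \<le> Re (ip u u)"
    using continuous_attains_sup[OF \<open>compact K\<close> \<open>K \<noteq> {}\<close> continuous_on_subset[OF cont_n]] by auto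
  define \<rho> where "\<rho> = Re (ip u u)"
  have uV: "u \<in> V" and qu: "q u = 1" using u by (auto simp: K_def)
  have bound: "Re (ip z z) \<le> \<rho> * q z" if z: "z \<in> V" for z
  proof (cases "q z = 0")
    case True
    then show ?thesis
      using ip_self_nonneg[of z] ip_self_nonneg[of "op z"] by (simp add: q_def)
  next
    case False
    then have pos: "q z > 0" using q_nonneg[of z] by simp
    define c where "c = complex_of_real (1 / sqrt (q z))"
    have c2: "(cmod c)\<^sup>2 = 1 / q z" using pos by (simp add: c_def power_divide norm_divide)
    have "(\<lambda>n. c * z n) \<in> K"
      using pos V_scale[OF z] by (simp add: K_def q_scale c2)
    then have "Re (ip (\<lambda>n. c * z n) (\<lambda>n. c * z n)) \<le> \<rho>" unfolding \<rho>_def by (rule max)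
    moreover have "ip (\<lambda>n. c * z n) (\<lambda>n. c * z n) = complex_of_real ((cmod c)\<^sup>2) * ip z z"
      by (simp add: ip_scale_left ip_scale_right complex_norm_square del: of_real_power)
    ultimately show ?thesis using pos by (simp add: c2 field_simps)
  qed
  have "\<rho> > 0"
  proof -
    have "Re (ip y y) > 0"
      using ip_self_eq_0[of y n] n yn ip_self_nonneg[of y] by fastforce
    then have "\<rho> * q y > 0" using bound[OF \<open>y \<in> V\<close>] by linarith
    then show ?thesis using qy zero_less_mult_pos2 by blast
  qed
  have "\<rho> \<le> 1" using qu ip_self_nonneg[of "op u"] by (simp add: q_def \<rho>_def)
  \<comment> \<open>Maximality of \<open>u\<close> makes this Hermitian form nonnegative on
    \<open>V\<close> with value 0 at \<open>u\<close>, so its first variation at \<open>u\<close>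
    vanishes.\<close>
  define B where "B x z = complex_of_real \<rho> * (ip x z + ip (op x) (op z)) - ip x z" for x z
  have B_nonneg: "0 \<le> Re (B z z)" if "z \<in> V" for z
    using bound[OF that] by (simp add: B_def q_def)
  have Buu: "Re (B u u) = 0"
  proof -
    have "Re (B u u) = \<rho> * q u - \<rho>" unfolding B_def q_def \<rho>_def by simp
    then show ?thesis by (simp add: qu)
  qed
  have op_add_fun: "op (\<lambda>n. x n + c * z n) = (\<lambda>n. op x n + c * op z n)" for x c z
    by (rule ext) (rule op_add)
  have cnj_B: "cnj (B x z) = B z x" for x z
    by (simp add: B_def cnj_ip)
  have Re_B: "Re (B u z) = 0" if z: "z \<in> V" for z
  proof (rule linear_coeff_eq_0)
    fix t
    have "0 \<le> Re (B (\<lambda>n. u n + complex_of_real t * z n) (\<lambda>n. u n + complex_of_real t * z n))"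
      by (intro B_nonneg V_add uV z)
    also have "B (\<lambda>n. u n + complex_of_real t * z n) (\<lambda>n. u n + complex_of_real t * z n)
        = B u u + complex_of_real t * (B u z + B z u) + complex_of_real (t\<^sup>2) * B z z"
      unfolding B_def op_add_fun ip_add_left ip_add_right
      by (simp add: algebra_simps power2_eq_square)
    also have "Re \<dots> = 2 * t * Re (B u z) + t\<^sup>2 * Re (B z z)"
      using Buu arg_cong[OF cnj_B[of u z], of Re] by (simp del: of_real_power)
    finally show "0 \<le> 2 * t * Re (B u z) + t\<^sup>2 * Re (B z z)" .
  qed
  have B_0: "B u z = 0" if z: "z \<in> V" for z
  proof (rule complex_eqI)
    have "B u (\<lambda>n. \<i> * z n) = - \<i> * B u z"
      by (simp add: B_def op_scale ip_scale_right algebra_simps)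
    then have "Im (B u z) = 0" using Re_B[OF V_scale[OF z, of \<i>]] by simp
    then show "Im (B u z) = Im 0" by simp
  qed (simp add: Re_B[OF z])
  \<comment> \<open>Stationarity reads \<open>\<rho>\<close> <l u, l z> = (1 -
    \<open>\<rho>\<close>) <u, z>; the square of \<open>\<nu>\<close> is the quotient of the two
    factors.\<close>
  define \<nu> where "\<nu> = sqrt ((1 - \<rho>) / \<rho>)"
  have \<nu>2: "\<nu>\<^sup>2 = (1 - \<rho>) / \<rho>" "\<nu> \<ge> 0"
    using \<open>\<rho> > 0\<close> \<open>\<rho> \<le> 1\<close> by (simp_all add: \<nu>_def)
  have eq_V: "ip (op u) (op z) = complex_of_real (\<nu>\<^sup>2) * ip u z" if "z \<in> V" for z
  proof -
    have "complex_of_real \<rho> * ip (op u) (op z) = complex_of_real (1 - \<rho>) * ip u z"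
      using B_0[OF that] by (simp add: B_def algebra_simps)
    then show ?thesis using \<open>\<rho> > 0\<close> unfolding \<nu>2 by (simp add: field_simps)
  qed
  have u_dom: "u \<in> dom" and u_e: "\<And>j. j < k \<Longrightarrow> ip u (e j) = 0" using uV by (auto simp: V_def)
  have ou_e: "ip (op u) (e j) = 0" if "j < k" for j
    using ip_op_e[OF that u_dom] u_e[OF that] by simp
  \<comment> \<open>Stationarity against \<open>V\<close> extends to the whole domain:
    \<open>u\<close> and \<open>op u\<close> are both orthogonal to the family, so replacing
    \<open>z\<close> by \<open>rest z\<close> changes neither side.\<close>
  have adjoint: "ip (op u) (op z) = ip (\<lambda>n. complex_of_real (\<nu>\<^sup>2) * u n) z" if z: "z \<in> dom" for z
  proof -
    have "rest z \<in> V" using rest_dom[OF z] rest_orthogonal by (simp add: V_def)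
    then have r: "ip (op u) (op (rest z)) = complex_of_real (\<nu>\<^sup>2) * ip u (rest z)" by (rule eq_V)
    have "op (rest z) = (\<lambda>n. op z n + (- 1) * (\<Sum>j<k. ip z (e j) * op (e j) n))"
      by (rule ext) (rule op_rest)
    then have 1: "ip (op u) (op (rest z)) = ip (op u) (op z)"
      using ou_e by (simp only: ip_add_right ip_sum_right) (simp add: ip_op_e_right)
    have "rest z = (\<lambda>n. z n + (- 1) * (\<Sum>j<k. ip z (e j) * e j n))"
      by (rule ext) (rule rest_def)
    then have 2: "ip u (rest z) = ip u z"
      using u_e by (simp only: ip_add_right ip_sum_right) simp
    show ?thesis using r unfolding 1 2 by (simp only: ip_scale_left)
  qed
  \<comment> \<open>\<open>op u\<close> itself need not lie in the domain; \<open>t\<close> does and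
    agrees with it on 1..N, so l can be applied a second time.\<close>
  obtain t where t_dom: "t \<in> dom"
    and t_values: "\<forall>n\<in>{1..N}. t n = op u n \<and> op t n = complex_of_real (\<nu>\<^sup>2) * u n"
    using op_maximal[OF adjoint] by blast
  note t = t_dom t_values[rule_format, THEN conjunct1, OF atLeastAtMost_iff[THEN iffD2, OF conjI]]
    t_values[rule_format, THEN conjunct2, OF atLeastAtMost_iff[THEN iffD2, OF conjI]]
  have t_e: "ip t (e j) = 0" if "j < k" for j
    using ou_e[OF that] ip_cong[of t "op u" "e j" "e j"] t(2) by simp
  \<comment> \<open>On 1..N, l (t + s u) = s^2 u + s t = s (t + s u), so \<open>no_more\<close>
    applies.\<close>
  have zero: "(\<lambda>n. t n + complex_of_real s * u n) = (\<lambda>_. 0)" if s: "s\<^sup>2 = \<nu>\<^sup>2" for s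
  proof (rule no_more)
    show "(\<lambda>n. t n + complex_of_real s * u n) \<in> dom" by (rule dom_add[OF t(1) u_dom])
    show "op (\<lambda>n. t n + complex_of_real s * u n) n = complex_of_real s * (t n + complex_of_real s * u n)"
      if "1 \<le> n" "n \<le> N" for n
      unfolding op_add t(2,3)[OF that] s[symmetric] by (simp add: algebra_simps power2_eq_square)
    show "ip (\<lambda>n. t n + complex_of_real s * u n) (e j) = 0" if "j < k" for j
      unfolding ip_add_left using t_e[OF that] u_e[OF that] by simp
  qed
  have "u = (\<lambda>_. 0)"
  \<comment> \<open>For \<open>\<nu> = 0\<close> the two combinations coincide, but then t = 0 makes
    \<open>u\<close> itself an eigenfunction for 0. Otherwise their difference 2
    \<open>\<nu>\<close> u is 0.\<close>
  proof (cases "\<nu> = 0")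
    case True
    then have "t = (\<lambda>_. 0)" using zero[of 0] by simp
    show ?thesis
      by (rule no_more[where lam=0]) (use u_dom u_e t(2) \<open>t = (\<lambda>_. 0)\<close> in auto)
  next
    case False
    have "t n + complex_of_real \<nu> * u n = 0" "t n + complex_of_real (- \<nu>) * u n = 0" for n
      using fun_cong[OF zero[of \<nu>], of n] fun_cong[OF zero[of "- \<nu>"], of n] by simp_all
    then have "2 * complex_of_real \<nu> * u n = 0" for n
      by (metis add_diff_cancel_left' diff_add_cancel mult_2 mult.assoc mult_minus_left of_real_minus diff_minus_eq_add diff_0_right)
    then show ?thesis using False by (simp add: fun_eq_iff)
  qed
  then show False using \<open>\<rho> > 0\<close> by (simp add: \<rho>_def sl_inner_def)
qed

end

section \<open>Eigenbases\<close>

lemma sum_fun_apply: "(\<Sum>i\<in>I. f i) x = (\<Sum>i\<in>I. f i x)" for f :: "'i \<Rightarrow> 'a \<Rightarrow> complex"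
  by (induction I rule: infinite_finite_induct) auto

lemma in_span_unit_sequences:
  assumes "\<forall>n\<ge>L. y n = 0"
  shows "y \<in> cseq.span ((\<lambda>i n. if n = i then 1 else 0) ` {..<L})"
proof -
  have "y = (\<Sum>i<L. (\<lambda>n. y i * (if n = i then 1 else 0)))"
  proof
    fix n
    have "(\<Sum>i<L. y i * (if n = i then 1 else 0)) = (\<Sum>i<L. if i = n then y n else 0)"
      by (intro sum.cong) auto
    also have "\<dots> = y n" using assms[rule_format, of n] by (auto simp: not_less)
    finally show "y n = (\<Sum>i<L. (\<lambda>n. y i * (if n = i then 1 else 0))) n"
      by (simp add: sum_fun_apply)
  qed
  also have "\<dots> \<in> cseq.span ((\<lambda>i n. if n = i then 1 else 0) ` {..<L})"
    by (intro cseq.span_sum cseq.span_scale[of "\<lambda>n. if n = _ then 1 else 0"] cseq.span_base) auto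
  finally show ?thesis .
qed

context regular_sl
begin

abbreviation eigenspace where "eigenspace \<equiv> solution_space N (\<omega>, bc_class M)"

lemmas eigenspace_eq = solution_space_bc_class[OF regular]

lemma eigenspace_add: "x \<in> eigenspace lam \<Longrightarrow> y \<in> eigenspace lam \<Longrightarrow> (\<lambda>n. x n + c * y n) \<in> eigenspace lam"
  by (auto simp: eigenspace_eq dom_add op_add algebra_simps)

lemma eigenspace_0: "(\<lambda>_. 0) \<in> eigenspace lam"
  using op_sum[of _ _ "{}"] by (simp add: eigenspace_eq dom_0)

lemma eigenspace_scale: "y \<in> eigenspace lam \<Longrightarrow> (\<lambda>n. c * y n) \<in> eigenspace lam"
  using eigenspace_add[OF eigenspace_0, of y lam c] by simp

lemma eigenspace_sum:
  "(\<And>i. i \<in> I \<Longrightarrow> x i \<in> eigenspace lam) \<Longrightarrow> (\<lambda>n. \<Sum>i\<in>I. \<alpha> i * x i n) \<in> eigenspace lam"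
  by (auto simp: eigenspace_eq dom_sum op_sum sum_distrib_left intro!: sum.cong)

lemma eigenfunction_norm_pos:
  assumes "y \<in> eigenspace lam" "y \<noteq> (\<lambda>_. 0)"
  shows "Re (ip y y) > 0"
proof (rule ccontr)
  assume "\<not> Re (ip y y) > 0"
  then have "Re (ip y y) = 0" using ip_self_nonneg[of y] by linarith
  then have "y n = 0" if "1 \<le> n" "n \<le> N" for n using ip_self_eq_0 that by blast
  then have "y = (\<lambda>_. 0)" using assms(1) by (intro dom_eq_0I) (auto simp: eigenspace_eq)
  with assms(2) show False by simp
qed

lemma ip_op_eigenfunction: "y \<in> eigenspace lam \<Longrightarrow> ip (op y) z = lam * ip y z"
  using ip_cong[of "op y" "\<lambda>n. lam * y n" z z] by (auto simp: eigenspace_eq ip_scale_left)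

lemma eigenspaces_symmetric:
  assumes "y \<in> eigenspace lam" "z \<in> eigenspace lam'"
  shows "lam * ip y z = cnj lam' * ip y z"
proof -
  have "lam * ip y z = ip y (op z)"
    using ip_op_eigenfunction[OF assms(1), of z] op_symmetric assms by (auto simp: eigenspace_eq)
  also have "\<dots> = cnj (ip (op z) y)" by (simp add: cnj_ip)
  also have "\<dots> = cnj lam' * ip y z" by (simp add: ip_op_eigenfunction[OF assms(2)] cnj_ip)
  finally show ?thesis .
qed

lemma eigenvalue_real:
  assumes "y \<in> eigenspace lam" "y \<noteq> (\<lambda>_. 0)"
  shows "complex_of_real (Re lam) = lam"
  using eigenspaces_symmetric[OF assms(1,1)] eigenfunction_norm_pos[OF assms]
  by (metis Reals_cnj_iff mult_cancel_right of_real_Re less_irrefl zero_complex.sel(1))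

lemma eigenspaces_orthogonal:
  assumes "y \<in> eigenspace lam" "z \<in> eigenspace lam'" "lam \<noteq> lam'"
  shows "ip y z = 0"
proof (cases "z = (\<lambda>_. 0)")
  case False
  then have "cnj lam' = lam'"
    using eigenvalue_real[OF assms(2)] by (metis complex_cnj_complex_of_real)
  then show ?thesis using eigenspaces_symmetric[OF assms(1,2)] assms(3) by simp
qed (simp add: sl_inner_def)

definition orthonormal_set :: "(nat \<Rightarrow> complex) set \<Rightarrow> bool" where
  "orthonormal_set C \<longleftrightarrow>
     C \<subseteq> (\<Union>lam. eigenspace lam) \<and> (\<forall>c\<in>C. \<forall>d\<in>C. ip c d = (if c = d then 1 else 0))"

lemma orthonormal_set_independent:
  assumes "orthonormal_set C"
  shows "cseq.independent C"
proof
  assume "cseq.dependent C"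
  then obtain T u v where T: "finite T" "T \<subseteq> C" "v \<in> T" "u v \<noteq> 0"
    and 0: "(\<Sum>c\<in>T. (\<lambda>n. u c * c n)) = 0"
    unfolding cseq.dependent_explicit by blast
  have "0 = ip (\<lambda>n. \<Sum>c\<in>T. u c * c n) v"
    using fun_cong[OF 0] by (simp add: sum_fun_apply sl_inner_def)
  also have "\<dots> = (\<Sum>c\<in>T. u c * ip c v)"
    by (rule ip_sum_left[of u "\<lambda>c. c" T])
  also have "\<dots> = (\<Sum>c\<in>T. if c = v then u v else 0)"
    using assms T(2,3) by (intro sum.cong refl) (auto simp: orthonormal_set_def subset_iff)
  finally show False using T by simp
qed

text \<open>The bound counts the coordinates \<open>y 0\<close>, ..., \<open>y (N + 1)\<close>; it
  guarantees that a largest orthonormal set exists.\<close>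

lemma orthonormal_set_bounded:
  assumes "orthonormal_set C"
  shows "finite C" "card C \<le> N + 2"
proof -
  have "c \<in> cseq.span ((\<lambda>i n. if n = i then 1 else 0) ` {..<N + 2})" if "c \<in> C" for c
    using that assms
    by (intro in_span_unit_sequences) (auto simp: orthonormal_set_def eigenspace_eq sl_domain_def subset_iff)
  then have "finite C \<and> card C \<le> card ((\<lambda>i (n::nat). if n = i then 1 else (0::complex)) ` {..<N + 2})"
    by (intro cseq.independent_span_bound orthonormal_set_independent assms) auto
  then show "finite C" "card C \<le> N + 2"
    using card_image_le[of "{..<N + 2}" "\<lambda>i (n::nat). if n = i then 1 else (0::complex)"] by auto
qed

text \<open>Take one of greatest cardinality: a nonzero eigenfunction orthogonal to it could be
  normalised and adjoined.\<close>

lemma maximal_orthonormal_set: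
  obtains C where "orthonormal_set C"
    "\<And>y lam. y \<in> eigenspace lam \<Longrightarrow> (\<And>c. c \<in> C \<Longrightarrow> ip y c = 0) \<Longrightarrow> y = (\<lambda>_. 0)"
proof -
  have 1: "orthonormal_set {}" by (simp add: orthonormal_set_def)
  have 2: "\<forall>C. orthonormal_set C \<longrightarrow> card C < Suc (N + 2)"
    using orthonormal_set_bounded(2) by (simp only: less_Suc_eq_le) blast
  obtain C where C: "orthonormal_set C" and max: "\<And>D. orthonormal_set D \<Longrightarrow> card D \<le> card C"
    using ex_has_greatest_nat[OF 1 2] by auto
  have "y = (\<lambda>_. 0)" if y: "y \<in> eigenspace lam" and orth: "\<And>c. c \<in> C \<Longrightarrow> ip y c = 0" for y lam
  proof (rule ccontr)
    assume "y \<noteq> (\<lambda>_. 0)"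
    then have pos: "Re (ip y y) > 0" using eigenfunction_norm_pos[OF y] by simp
    define s where "s = complex_of_real (1 / sqrt (Re (ip y y)))"
    define z where "z = (\<lambda>n. s * y n)"
    have "s * s * complex_of_real (Re (ip y y)) = 1"
      using pos by (simp add: s_def flip: of_real_mult)
    moreover have "cnj s = s" by (simp add: s_def)
    then have "ip z z = s * s * ip y y"
      by (simp add: z_def ip_scale_left ip_scale_right)
    ultimately have zz: "ip z z = 1" by (subst (asm) (2) ip_self_of_real) simp
    have zc: "ip z c = 0" "ip c z = 0" if "c \<in> C" for c
      using orth[OF that] cnj_ip[of z c] by (simp_all add: z_def ip_scale_left ip_scale_right flip: cnj_ip[of y c])
    have "z \<notin> C" using zc(1) zz by force
    moreover have "orthonormal_set (insert z C)"
      using C zz zc eigenspace_scale[OF y, of s] by (auto simp: orthonormal_set_def z_def[symmetric])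
    ultimately show False
      using max[of "insert z C"] orthonormal_set_bounded[OF C] by simp
  qed
  with C show thesis by (rule that)
qed

text \<open>Links the multiset behind \<open>eigenvalue\<close> with an indexed family. Grouped by
  eigenvalue, a maximal orthonormal set gives a basis of each eigenspace, so the group sizes are the
  multiplicities; sorting then matches the jth member with the jth eigenvalue.\<close>

lemma eigenbasis_exists:
  assumes num: "num_eigenvalues N (\<omega>, bc_class M) = k"
  obtains e where "sl_eigenbasis N \<omega> M k e (\<lambda>j. eigenvalue N j (\<omega>, bc_class M))"
proof -
  obtain C where C: "orthonormal_set C"
    and max: "\<And>y lam. y \<in> eigenspace lam \<Longrightarrow> (\<And>c. c \<in> C \<Longrightarrow> ip y c = 0) \<Longrightarrow> y = (\<lambda>_. 0)"
    by (rule maximal_orthonormal_set) blast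
  note fin = orthonormal_set_bounded(1)[OF C]
  have on: "ip c d = (if c = d then 1 else 0)" if "c \<in> C" "d \<in> C" for c d
    using C that by (auto simp: orthonormal_set_def)
  have nz: "c \<noteq> (\<lambda>_. 0)" if "c \<in> C" for c
    using on[OF that that] by (auto simp: sl_inner_def)
  have "\<forall>c\<in>C. \<exists>lam. c \<in> eigenspace lam" using C by (auto simp: orthonormal_set_def)
  then obtain ev where ev: "\<And>c. c \<in> C \<Longrightarrow> c \<in> eigenspace (ev c)" by metis
  define Cl where "Cl lam = {c \<in> C. ev c = lam}" for lam
  have spans: "eigenspace lam \<subseteq> cseq.span (Cl lam)" for lam
  proof
    fix y assume y: "y \<in> eigenspace lam"
    \<comment> \<open>\<open>z\<close> stays in the eigenspace of \<open>lam\<close>, hence is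
      orthogonal also to the members with other eigenvalues; maximality gives z = 0.\<close>
    define z where "z = (\<lambda>n. y n + (- 1) * (\<Sum>c\<in>Cl lam. ip y c * c n))"
    have z: "z \<in> eigenspace lam"
      unfolding z_def by (intro eigenspace_add eigenspace_sum y) (auto simp: Cl_def dest: ev)
    have "ip z c = 0" if c: "c \<in> C" for c
    proof (cases "ev c = lam")
      case True
      then have "c \<in> Cl lam" using c by (simp add: Cl_def)
      have "ip z c = ip y c + (- 1) * (\<Sum>d\<in>Cl lam. ip y d * ip d c)"
        unfolding z_def ip_add_left using ip_sum_left[of "ip y" "\<lambda>c. c" "Cl lam" c] by simp
      also have "(\<Sum>d\<in>Cl lam. ip y d * ip d c) = (\<Sum>d\<in>Cl lam. if d = c then ip y c else 0)"
        using c by (intro sum.cong refl) (auto simp: Cl_def on)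
      also have "\<dots> = ip y c" using \<open>c \<in> Cl lam\<close> fin by (simp add: Cl_def)
      finally show ?thesis by simp
    next
      case False
      then show ?thesis using eigenspaces_orthogonal[OF z ev[OF c]] by simp
    qed
    then have "z = (\<lambda>_. 0)" using max[OF z] by blast
    then have "y = (\<Sum>c\<in>Cl lam. (\<lambda>n. ip y c * c n))"
      by (simp add: z_def fun_eq_iff sum_fun_apply)
    also have "\<dots> \<in> cseq.span (Cl lam)"
      by (intro cseq.span_sum cseq.span_scale cseq.span_base)
    finally show "y \<in> cseq.span (Cl lam)" .
  qed
  have mult: "multiplicity_of N (\<omega>, bc_class M) lam = card (Cl lam)" for lam
    unfolding multiplicity_of_def
  proof (rule cseq.dim_unique[OF _ spans _ refl])
    show "Cl lam \<subseteq> eigenspace lam" using ev by (auto simp: Cl_def)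
    show "cseq.independent (Cl lam)"
      using orthonormal_set_independent[OF C] by (rule cseq.independent_mono) (auto simp: Cl_def)
  qed
  have evs: "eigenvalues N (\<omega>, bc_class M) = ev ` C"
  proof
    show "ev ` C \<subseteq> eigenvalues N (\<omega>, bc_class M)"
      using ev nz by (auto simp: eigenvalues_def)
    show "eigenvalues N (\<omega>, bc_class M) \<subseteq> ev ` C"
    proof
      fix lam assume "lam \<in> eigenvalues N (\<omega>, bc_class M)"
      then obtain y where "y \<in> eigenspace lam" "y \<noteq> (\<lambda>_. 0)" by (auto simp: eigenvalues_def)
      then have "Cl lam \<noteq> {}" using spans[of lam] by (auto simp: zero_fun_def)
      then show "lam \<in> ev ` C" by (auto simp: Cl_def)
    qed
  qed
  have mset: "eigenvalue_mset N (\<omega>, bc_class M) = image_mset ev (mset_set C)"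
  proof (rule multiset_eqI)
    fix x
    have "count (eigenvalue_mset N (\<omega>, bc_class M)) x = (\<Sum>lam\<in>ev ` C. if lam = x then card (Cl x) else 0)"
      unfolding eigenvalue_mset_def evs mult count_sum by (intro sum.cong) auto
    also have "\<dots> = card (Cl x)" using fin by (auto simp: Cl_def)
    also have "\<dots> = count (image_mset ev (mset_set C)) x"
      using fin by (simp add: count_image_mset Cl_def) (auto intro!: arg_cong[where f=card])
    finally show "count (eigenvalue_mset N (\<omega>, bc_class M)) x = count (image_mset ev (mset_set C)) x" .
  qed
  have card: "card C = k" using num fin by (simp add: num_eigenvalues_def mset)
  obtain xs where xs: "set xs = C" "distinct xs" using finite_distinct_list[OF fin] by blast
  define ys where "ys = sort_key (Re \<circ> ev) xs"
  have ys: "set ys = C" "distinct ys" "sorted (map (Re \<circ> ev) ys)" "mset ys = mset_set C"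
    using xs mset_set_set[OF xs(2)] by (simp_all add: ys_def)
  have len: "length ys = k" using ys distinct_card card by metis
  have "sorted_list_of_multiset (image_mset Re (eigenvalue_mset N (\<omega>, bc_class M))) = map (Re \<circ> ev) ys"
  proof -
    have "image_mset Re (eigenvalue_mset N (\<omega>, bc_class M)) = mset (map (Re \<circ> ev) ys)"
      by (simp add: mset ys(4) multiset.map_comp)
    then show ?thesis using ys(3) by (simp add: sorted_sort_id del: mset_map)
  qed
  then have val: "eigenvalue N j (\<omega>, bc_class M) = Re (ev (ys ! j))" if "j < k" for j
    using that len by (simp add: eigenvalue_def)
  have inC: "ys ! j \<in> C" if "j < k" for j using that len ys(1) nth_mem by blast
  have val': "complex_of_real (eigenvalue N j (\<omega>, bc_class M)) = ev (ys ! j)" if "j < k" for j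
    using val[OF that] eigenvalue_real[OF ev nz] inC[OF that] by simp
  have "sl_eigenbasis N \<omega> M k (\<lambda>j. ys ! j) (\<lambda>j. eigenvalue N j (\<omega>, bc_class M))"
  proof
    fix j n assume j: "j < k"
    show "ys ! j \<in> dom" using ev[OF inC[OF j]] by (simp add: eigenspace_eq)
    show "op (ys ! j) n = complex_of_real (eigenvalue N j (\<omega>, bc_class M)) * (ys ! j) n" if "1 \<le> n" "n \<le> N"
      using ev[OF inC[OF j]] val'[OF j] that by (simp add: eigenspace_eq)
  next
    fix i j assume "i < k" "j < k"
    then show "ip (ys ! i) (ys ! j) = (if i = j then 1 else 0)"
      using on[OF inC inC] ys(2) len by (simp add: nth_eq_iff_index_eq)
  next
    fix y lam
    assume y: "y \<in> dom" "\<And>n. 1 \<le> n \<Longrightarrow> n \<le> N \<Longrightarrow> op y n = complex_of_real lam * y n"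
      and orth: "\<And>j. j < k \<Longrightarrow> ip y (ys ! j) = 0"
    show "y = (\<lambda>_. 0)"
    proof (rule max)
      show "y \<in> eigenspace (complex_of_real lam)" using y by (auto simp: eigenspace_eq)
      show "ip y c = 0" if "c \<in> C" for c
        using that orth ys(1) len by (metis in_set_conv_nth)
    qed
  qed
  then show thesis by (rule that)
qed

end

lemma eigenvalue_mono:
  assumes "i \<le> j" "j < num_eigenvalues N P"
  shows "eigenvalue N i P \<le> eigenvalue N j P"
proof -
  let ?A = "image_mset Re (eigenvalue_mset N P)"
  have "length (sorted_list_of_multiset ?A) = num_eigenvalues N P"
    by (metis mset_sorted_list_of_multiset num_eigenvalues_def size_image_mset size_mset)
  then show ?thesis
    unfolding eigenvalue_def using assms by (intro sorted_nth_mono) auto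
qed

section \<open>Counting eigenvalues near a point\<close>

text \<open>Gaussian elimination by induction on the equations: equation \<open>j\<close> is solved
  for an unknown \<open>i0\<close> occurring in it and substituted into the others.\<close>

lemma homogeneous_system_nontrivial_solution:
  fixes a :: "'i \<Rightarrow> 'j \<Rightarrow> complex"
  assumes "finite J" "finite I" "card J < card I"
  shows "\<exists>x. (\<exists>i\<in>I. x i \<noteq> 0) \<and> (\<forall>j\<in>J. (\<Sum>i\<in>I. x i * a i j) = 0)"
  using assms
proof (induction J arbitrary: I a rule: finite_induct)
  case empty
  then obtain i where "i \<in> I" by fastforce
  then show ?case by (intro exI[of _ "\<lambda>_. 1"]) auto
next
  case (insert j J)
  show ?case
  proof (cases "\<forall>i\<in>I. a i j = 0")
    case True
    have "card J < card I" using insert by simp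
    then obtain x where "\<exists>i\<in>I. x i \<noteq> 0" "\<forall>l\<in>J. (\<Sum>i\<in>I. x i * a i l) = 0"
      using insert.IH[OF insert.prems(1)] by blast
    then show ?thesis using True by auto
  next
    case False
    then obtain i0 where i0: "i0 \<in> I" "a i0 j \<noteq> 0" by blast
    define I' where "I' = I - {i0}"
    have I': "finite I'" "card J < card I'" using insert i0 by (auto simp: I'_def)
    obtain x where x: "\<exists>i\<in>I'. x i \<noteq> 0"
      "\<forall>l\<in>J. (\<Sum>i\<in>I'. x i * (a i l - a i j / a i0 j * a i0 l)) = 0"
      using insert.IH[OF I', of "\<lambda>i l. a i l - a i j / a i0 j * a i0 l"] by blast
    \<comment> \<open>Back substitution: \<open>- s\<close> is the value that equation
      \<open>j\<close> prescribes for the eliminated unknown.\<close>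
    define s where "s = (\<Sum>i\<in>I'. x i * a i j) / a i0 j"
    define x' where "x' = x(i0 := - s)"
    have sum: "(\<Sum>i\<in>I. x' i * a i l) = (\<Sum>i\<in>I'. x i * a i l) - s * a i0 l" for l
    proof -
      have "(\<Sum>i\<in>I'. x' i * a i l) = (\<Sum>i\<in>I'. x i * a i l)"
        by (intro sum.cong) (auto simp: x'_def I'_def)
      then show ?thesis
        using insert.prems(1) i0(1) by (simp add: sum.remove[of I i0] x'_def I'_def)
    qed
    have "(\<Sum>i\<in>I. x' i * a i l) = 0" if "l \<in> J" for l
    proof -
      have "(\<Sum>i\<in>I'. x i * (a i l - a i j / a i0 j * a i0 l)) = (\<Sum>i\<in>I'. x i * a i l) - s * a i0 l"
        by (simp add: algebra_simps sum_subtractf s_def sum_distrib_left sum_divide_distrib)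
      then show ?thesis using x(2) that unfolding sum by simp
    qed
    moreover have "(\<Sum>i\<in>I. x' i * a i j) = 0"
      unfolding sum s_def using i0(2) by simp
    moreover have "\<exists>i\<in>I. x' i \<noteq> 0"
      using x(1) by (auto simp: I'_def x'_def)
    ultimately show ?thesis by (intro exI[of _ x']) auto
  qed
qed

text \<open>With tolerance \<open>\<kappa> / (real d + 1)\<close> the perturbation contributes at
  most d / (d + 1) times \<open>\<kappa>\<close> |x|^2, strictly less than the diagonal takes
  away.\<close>

lemma near_negative_diagonal_form_negative:
  fixes D :: "nat \<Rightarrow> nat \<Rightarrow> complex" and \<delta> :: "nat \<Rightarrow> real"
  assumes \<kappa>: "\<kappa> > 0" and \<delta>: "\<And>i. i < d \<Longrightarrow> \<delta> i \<le> - \<kappa>"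
    and near: "\<And>i j. i < d \<Longrightarrow> j < d \<Longrightarrow>
      cmod (D i j - complex_of_real (if i = j then \<delta> i else 0)) \<le> \<kappa> / (real d + 1)"
    and nz: "\<exists>i<d. x i \<noteq> 0"
  shows "Re (\<Sum>i<d. \<Sum>j<d. x i * cnj (x j) * D i j) < 0"
proof -
  define S where "S = (\<Sum>i<d. (cmod (x i))\<^sup>2)"
  define \<eta> where "\<eta> = \<kappa> / (real d + 1)"
  have "\<eta> > 0" using \<kappa> by (simp add: \<eta>_def)
  have "S > 0"
  proof -
    obtain i where i: "i < d" "x i \<noteq> 0" using nz by blast
    then have "0 < (cmod (x i))\<^sup>2" by simp
    also have "\<dots> \<le> S" unfolding S_def using i(1) by (intro member_le_sum) auto
    finally show ?thesis .
  qed
  let ?\<Delta> = "\<lambda>i j. complex_of_real (if i = j then \<delta> i else 0)"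
  have "(\<Sum>i<d. \<Sum>j<d. x i * cnj (x j) * D i j) =
      (\<Sum>i<d. \<Sum>j<d. x i * cnj (x j) * (D i j - ?\<Delta> i j)) + (\<Sum>i<d. \<Sum>j<d. x i * cnj (x j) * ?\<Delta> i j)"
    by (simp add: algebra_simps flip: sum.distrib)
  moreover have "(\<Sum>i<d. \<Sum>j<d. x i * cnj (x j) * ?\<Delta> i j) = complex_of_real (\<Sum>i<d. (cmod (x i))\<^sup>2 * \<delta> i)"
  proof -
    have "(\<Sum>j<d. x i * cnj (x j) * ?\<Delta> i j) = complex_of_real ((cmod (x i))\<^sup>2 * \<delta> i)" if "i < d" for i
    proof -
      have "(\<Sum>j<d. x i * cnj (x j) * ?\<Delta> i j) = (\<Sum>j<d. if j = i then x i * cnj (x i) * complex_of_real (\<delta> i) else 0)"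
        by (intro sum.cong) auto
      then show ?thesis using that by (simp add: complex_norm_square del: of_real_power)
    qed
    then show ?thesis by simp
  qed
  ultimately have "Re (\<Sum>i<d. \<Sum>j<d. x i * cnj (x j) * D i j) =
      Re (\<Sum>i<d. \<Sum>j<d. x i * cnj (x j) * (D i j - ?\<Delta> i j)) + (\<Sum>i<d. (cmod (x i))\<^sup>2 * \<delta> i)"
    by simp
  also have "Re (\<Sum>i<d. \<Sum>j<d. x i * cnj (x j) * (D i j - ?\<Delta> i j)) \<le> \<eta> * (real d * S)"
  proof -
    have "Re (\<Sum>i<d. \<Sum>j<d. x i * cnj (x j) * (D i j - ?\<Delta> i j))
        \<le> cmod (\<Sum>i<d. \<Sum>j<d. x i * cnj (x j) * (D i j - ?\<Delta> i j))"
      by (rule complex_Re_le_cmod)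
    also have "\<dots> \<le> (\<Sum>i<d. \<Sum>j<d. \<eta> * (((cmod (x i))\<^sup>2 + (cmod (x j))\<^sup>2) / 2))"
    proof (intro sum_norm_le)
      fix i j assume ij: "i \<in> {..<d}" "j \<in> {..<d}"
      have "cmod (x i) * cmod (x j) \<le> ((cmod (x i))\<^sup>2 + (cmod (x j))\<^sup>2) / 2"
        using sum_squares_bound[of "cmod (x i)" "cmod (x j)"] by simp
      moreover have "cmod (D i j - ?\<Delta> i j) \<le> \<eta>" using near[of i j] ij by (simp add: \<eta>_def)
      ultimately have "cmod (D i j - ?\<Delta> i j) * (cmod (x i) * cmod (x j)) \<le> \<eta> * (((cmod (x i))\<^sup>2 + (cmod (x j))\<^sup>2) / 2)"
        using \<open>\<eta> > 0\<close> by (intro mult_mono) auto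
      then show "cmod (x i * cnj (x j) * (D i j - ?\<Delta> i j)) \<le> \<eta> * (((cmod (x i))\<^sup>2 + (cmod (x j))\<^sup>2) / 2)"
        by (simp add: norm_mult mult_ac)
    qed
    also have "\<dots> = \<eta> * (\<Sum>i<d. \<Sum>j<d. ((cmod (x i))\<^sup>2 + (cmod (x j))\<^sup>2) / 2)"
      by (simp add: sum_distrib_left)
    also have "(\<Sum>i<d. \<Sum>j<d. ((cmod (x i))\<^sup>2 + (cmod (x j))\<^sup>2) / 2) = real d * S"
      unfolding S_def by (simp add: sum.distrib sum_distrib_left add_divide_distrib flip: sum_divide_distrib)
    finally show ?thesis .
  qed
  also have "(\<Sum>i<d. (cmod (x i))\<^sup>2 * \<delta> i) \<le> (\<Sum>i<d. (cmod (x i))\<^sup>2 * (- \<kappa>))"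
    by (intro sum_mono mult_left_mono \<delta>) auto
  also have "\<dots> = - \<kappa> * S" by (simp add: S_def sum_distrib_left mult.commute sum_negf)
  also have "\<eta> * (real d * S) + - \<kappa> * S = - \<eta> * S"
    by (simp add: \<eta>_def field_simps)
  also have "\<dots> < 0" using \<open>S > 0\<close> \<open>\<eta> > 0\<close> by simp
  finally show ?thesis by simp
qed

context sl_eigenbasis
begin

lemma ip_rest_self: "Re (ip (rest v) (rest v)) = Re (ip v v) - (\<Sum>j<k. (cmod (ip v (e j)))\<^sup>2)"
proof -
  have "ip (rest v) (rest v) = ip (rest v) (\<lambda>n. v n + (- 1) * (\<Sum>j<k. ip v (e j) * e j n))"
    by (rule arg_cong[of _ _ "ip (rest v)"]) (simp add: rest_def fun_eq_iff)
  also have "\<dots> = ip (rest v) v"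
    by (simp only: ip_add_right ip_sum_right) (simp add: rest_orthogonal)
  also have "\<dots> = ip (\<lambda>n. v n + (- 1) * (\<Sum>j<k. ip v (e j) * e j n)) v"
    by (rule arg_cong[of _ _ "\<lambda>u. ip u v"]) (simp add: rest_def fun_eq_iff)
  also have "\<dots> = ip v v - (\<Sum>j<k. ip v (e j) * cnj (ip v (e j)))"
    by (simp only: ip_add_left ip_sum_left cnj_ip) simp
  finally show ?thesis
    by (simp add: complex_norm_square[symmetric] flip: of_real_sum del: of_real_power)
qed

text \<open>By completeness \<open>rest y\<close> vanishes on 1..N; the inner product does not see
  the values at 0 and N + 1.\<close>

lemma parseval: "y \<in> dom \<Longrightarrow> Re (ip y y) = (\<Sum>j<k. (cmod (ip y (e j)))\<^sup>2)"
proof -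
  assume "y \<in> dom"
  then have "rest y n = 0" if "1 \<le> n" "n \<le> N" for n
    using complete[OF rest_dom] rest_orthogonal that by blast
  then have "ip (rest y) (rest y) = 0" by (simp add: sl_inner_def)
  then show ?thesis using ip_rest_self[of y] by simp
qed

text \<open>Stated for arbitrary \<open>v\<close> because it is applied to l y - c y, which need not
  lie in the domain.\<close>

lemma bessel: "(\<Sum>j<k. (cmod (ip v (e j)))\<^sup>2) \<le> Re (ip v v)"
  using ip_rest_self[of v] ip_self_nonneg[of "rest v"] by simp

text \<open>With fewer than \<open>d\<close> such eigenvalues, some combination \<open>y\<close> of the \<open>z i\<close> is orthogonal to all
  their eigenfunctions, and then \<open>\<parallel>l y - c y\<parallel> \<ge> r \<parallel>y\<parallel>\<close> by the inequalities of Bessel and Parseval.\<close>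

lemma eigenvalues_near:
  assumes z: "\<And>i. i < d \<Longrightarrow> z i \<in> dom" and "r \<ge> 0"
    and neg: "\<And>x. \<exists>i<d. x i \<noteq> 0 \<Longrightarrow>
      Re (\<Sum>i<d. \<Sum>j<d. x i * cnj (x j) *
        (ip (\<lambda>n. op (z i) n - complex_of_real c * z i n) (\<lambda>n. op (z j) n - complex_of_real c * z j n)
          - complex_of_real (r\<^sup>2) * ip (z i) (z j))) < 0"
  shows "d \<le> card {j. j < k \<and> \<bar>\<mu> j - c\<bar> \<le> r}"
proof (rule ccontr)
  assume "\<not> d \<le> card {j. j < k \<and> \<bar>\<mu> j - c\<bar> \<le> r}"
  then have "card {j. j < k \<and> \<bar>\<mu> j - c\<bar> \<le> r} < card {..<d}" by simp
  then have "\<exists>x. (\<exists>i\<in>{..<d}. x i \<noteq> 0) \<and> (\<forall>j\<in>{j. j < k \<and> \<bar>\<mu> j - c\<bar> \<le> r}. (\<Sum>i\<in>{..<d}. x i * ip (z i) (e j)) = 0)"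
    by (intro homogeneous_system_nontrivial_solution) auto
  then obtain x where x: "\<exists>i<d. x i \<noteq> 0"
    "\<And>j. j < k \<Longrightarrow> \<bar>\<mu> j - c\<bar> \<le> r \<Longrightarrow> (\<Sum>i<d. x i * ip (z i) (e j)) = 0" by auto
  define y where "y = (\<lambda>n. \<Sum>i<d. x i * z i n)"
  define v where "v = (\<lambda>n. op y n + (- complex_of_real c) * y n)"
  define zc where "zc = (\<lambda>i n. op (z i) n - complex_of_real c * z i n)"
  have y: "y \<in> dom" unfolding y_def by (intro dom_sum z) auto
  have ye: "ip y (e j) = (\<Sum>i<d. x i * ip (z i) (e j))" for j unfolding y_def by (rule ip_sum_left)
  \<comment> \<open>Symmetry moves l onto \<open>e j\<close>; the coefficients outside the interval
    thus grow by a factor of absolute value above \<open>r\<close>.\<close>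
  have ve: "ip v (e j) = complex_of_real (\<mu> j - c) * ip y (e j)" if "j < k" for j
    unfolding v_def ip_add_left ip_op_e[OF that y] by (simp add: algebra_simps)
  have "r\<^sup>2 * Re (ip y y) = (\<Sum>j<k. r\<^sup>2 * (cmod (ip y (e j)))\<^sup>2)"
    by (simp add: parseval[OF y] sum_distrib_left)
  also have "\<dots> \<le> (\<Sum>j<k. (cmod (ip v (e j)))\<^sup>2)"
  proof (intro sum_mono)
    fix j assume "j \<in> {..<k}"
    then have j: "j < k" by simp
    show "r\<^sup>2 * (cmod (ip y (e j)))\<^sup>2 \<le> (cmod (ip v (e j)))\<^sup>2"
    proof (cases "\<bar>\<mu> j - c\<bar> \<le> r")
      case True
      then show ?thesis using x(2)[OF j True] by (simp add: ye)
    next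
      case False
      then have "r\<^sup>2 \<le> (\<mu> j - c)\<^sup>2" using \<open>r \<ge> 0\<close> by (intro abs_le_square_iff[THEN iffD1]) auto
      then show ?thesis
        unfolding ve[OF j] norm_mult norm_of_real power_mult_distrib power2_abs by (intro mult_right_mono) auto
    qed
  qed
  also have "\<dots> \<le> Re (ip v v)" by (rule bessel)
  finally have le: "r\<^sup>2 * Re (ip y y) \<le> Re (ip v v)" .
  have "v = (\<lambda>n. \<Sum>i<d. x i * zc i n)"
    by (simp add: v_def y_def zc_def op_sum fun_eq_iff sum_distrib_left sum_subtractf sum_negf algebra_simps)
  then have "ip v v = (\<Sum>i<d. \<Sum>j<d. x i * cnj (x j) * ip (zc i) (zc j))"
    by (simp add: ip_sum_left ip_sum_right sum_distrib_left mult.assoc)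
  moreover have "ip y y = (\<Sum>i<d. \<Sum>j<d. x i * cnj (x j) * ip (z i) (z j))"
    by (simp add: y_def ip_sum_left ip_sum_right sum_distrib_left mult.assoc)
  ultimately have "(\<Sum>i<d. \<Sum>j<d. x i * cnj (x j) * (ip (zc i) (zc j) - complex_of_real (r\<^sup>2) * ip (z i) (z j)))
      = ip v v - complex_of_real (r\<^sup>2) * ip y y"
    by (simp add: algebra_simps sum_subtractf sum_distrib_left)
  then have "Re (ip v v) - r\<^sup>2 * Re (ip y y) < 0"
    using neg[OF x(1)] unfolding zc_def by (simp del: of_real_power)
  with le show False by simp
qed

end

section \<open>Dependence on the problem\<close>

text \<open>Makes \<open>with_boundary\<close> a deformation that starts at a given element of the
  domain.\<close>

lemma (in regular_sl) with_boundary_self: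
  assumes "y \<in> dom"
  shows "with_boundary N \<omega> (boundary_vector N \<omega> y) y = y"
proof
  fix n
  show "with_boundary N \<omega> (boundary_vector N \<omega> y) y n = y n"
    using assms quasi_diff_eq[of 0 y] quasi_diff_eq[of N y]
    by (auto simp: with_boundary_def boundary_vector_def sl_domain_def)
qed

text \<open>Formulated for matrices, whose entries have limits, instead of classes; a general filter
  leaves open how representatives are chosen.\<close>

definition approaches ::
    "nat \<Rightarrow> (sl_equation \<times> bc_matrix) filter \<Rightarrow> sl_equation \<Rightarrow> bc_matrix \<Rightarrow> bool" where
  "approaches N F \<omega> M \<longleftrightarrow>
     (\<forall>n\<in>{0..N}. ((\<lambda>p. fst (fst p) n) \<longlongrightarrow> fst \<omega> n) F) \<and>
     (\<forall>n\<in>{1..N}. ((\<lambda>p. sl_q (fst p) n) \<longlongrightarrow> sl_q \<omega> n) F) \<and>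
     (\<forall>n\<in>{1..N}. ((\<lambda>p. sl_w (fst p) n) \<longlongrightarrow> sl_w \<omega> n) F) \<and>
     (snd \<longlongrightarrow> M) F"

context regular_sl
begin

context
  fixes F :: "(sl_equation \<times> bc_matrix) filter"
  assumes F: "approaches N F \<omega> M"
begin

lemma tendsto_lagrange_vector:
  "((\<lambda>p. lagrange_vector (snd p) c $ i) \<longlongrightarrow> lagrange_vector M c $ i) F"
proof -
  have entry: "((\<lambda>p. snd p $ r $ j) \<longlongrightarrow> M $ r $ j) F" for r j
    using F unfolding approaches_def by (intro tendsto_vec_nth) auto
  then have "\<forall>i. ((\<lambda>p. lagrange_vector (snd p) c $ i) \<longlongrightarrow> lagrange_vector M c $ i) F"
    unfolding forall_2p2 lagrange_vector_def Let_def vec4_nth conj_transpose_mult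
    by (intro conjI tendsto_minus tendsto_add tendsto_mult tendsto_cnj tendsto_const entry)
  then show ?thesis by blast
qed

lemma tendsto_with_boundary:
  "((\<lambda>p. with_boundary N (fst p) (lagrange_vector (snd p) c) a n) \<longlongrightarrow>
     with_boundary N \<omega> (lagrange_vector M c) a n) F"
proof -
  have "((\<lambda>p. fst (fst p) 0) \<longlongrightarrow> fst \<omega> 0) F" "((\<lambda>p. fst (fst p) N) \<longlongrightarrow> fst \<omega> N) F"
    using F by (auto simp: approaches_def)
  then show ?thesis
    unfolding with_boundary_def
    by (cases "n = 0"; cases "n = 1"; cases "n = N"; cases "n = N + 1")
      (auto intro!: tendsto_intros tendsto_lagrange_vector simp del: One_nat_def)
qed

lemma tendsto_sl_operator:
  assumes y: "\<And>n. ((\<lambda>p. y p n) \<longlongrightarrow> y0 n) F" and n: "1 \<le> n" "n \<le> N"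
  shows "((\<lambda>p. sl_operator (fst p) (y p) n) \<longlongrightarrow> op y0 n) F"
proof -
  have "((\<lambda>p. sl_f (fst p) i) \<longlongrightarrow> sl_f \<omega> i) F" if "i \<le> N" for i
    unfolding sl_f_def using F g_nz[OF that] that by (intro tendsto_intros) (auto simp: approaches_def)
  then have "((\<lambda>p. quasi_diff (fst p) (y p) i) \<longlongrightarrow> quasi_diff \<omega> y0 i) F" if "i \<le> N" for i
    unfolding quasi_diff_def fwd_diff_def using that by (intro tendsto_intros y) auto
  then show ?thesis
    unfolding sl_operator_def bwd_diff_def using n w_pos[OF n] F
    by (intro tendsto_intros y) (auto simp: approaches_def)
qed

lemma tendsto_sl_inner:
  assumes "\<And>n. 1 \<le> n \<Longrightarrow> n \<le> N \<Longrightarrow> ((\<lambda>p. x p n) \<longlongrightarrow> x0 n) F"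
    "\<And>n. 1 \<le> n \<Longrightarrow> n \<le> N \<Longrightarrow> ((\<lambda>p. y p n) \<longlongrightarrow> y0 n) F"
  shows "((\<lambda>p. sl_inner N (fst p) (x p) (y p)) \<longlongrightarrow> ip x0 y0) F"
  unfolding sl_inner_def using F
  by (intro tendsto_intros assms) (auto simp: approaches_def)

end

end

text \<open>The bases are quantified inside the eventuality: only trial functions are deformed, so
  one neighbourhood serves every eigenbasis of every problem in it.\<close>

lemma (in sl_eigenbasis) eigenvalues_persist:
  assumes F: "approaches N F \<omega> M"
    and J: "J + d \<le> k" "\<And>i. i < d \<Longrightarrow> \<bar>\<mu> (J + i) - c\<bar> \<le> r" and "0 \<le> r" "r < s"
  shows "\<forall>\<^sub>F p in F. \<forall>k' e' \<mu>'. sl_eigenbasis N (fst p) (snd p) k' e' \<mu>' \<longrightarrow>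
    d \<le> card {j. j < k' \<and> \<bar>\<mu>' j - c\<bar> \<le> s}"
proof -
  have "\<exists>b. boundary_vector N \<omega> (e (J + i)) = lagrange_vector M b" if "i < d" for i
    using kernel_eq_lagrange[OF rank_2 sa, of "boundary_vector N \<omega> (e (J + i))"] e_dom[of "J + i"] that J(1)
    by (auto simp: sl_domain_def)
  then obtain b where b: "\<And>i. i < d \<Longrightarrow> boundary_vector N \<omega> (e (J + i)) = lagrange_vector M (b i)"
    by metis
  \<comment> \<open>Parameter \<open>b i\<close> and interior values are kept while the equation and
    the matrix change; so the nearby boundary condition holds exactly.\<close>
  define z where "z p i = with_boundary N (fst p) (lagrange_vector (snd p) (b i)) (e (J + i))"
    for p :: "sl_equation \<times> bc_matrix" and i
  define v where "v p i n = sl_operator (fst p) (z p i) n - complex_of_real c * z p i n"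
    for p :: "sl_equation \<times> bc_matrix" and i n
  \<comment> \<open>The matrix of |l y - c y|^2 - s^2 |y|^2 on the trial functions. In the limit
    these are orthonormal eigenfunctions, so it tends to the diagonal matrix with entries
    \<open>\<delta> i\<close>.\<close>
  define D where "D p i j = sl_inner N (fst p) (v p i) (v p j)
      - complex_of_real (s\<^sup>2) * sl_inner N (fst p) (z p i) (z p j)" for p i j
  define \<delta> where "\<delta> i = (\<mu> (J + i) - c)\<^sup>2 - s\<^sup>2" for i
  define \<kappa> where "\<kappa> = s\<^sup>2 - r\<^sup>2"
  have "\<kappa> > 0" using assms(4,5) by (simp add: \<kappa>_def power_strict_mono)
  have \<delta>: "\<delta> i \<le> - \<kappa>" if "i < d" for i
    using power_mono[OF J(2)[OF that], of 2] by (simp add: \<delta>_def \<kappa>_def)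
  have lim_z: "((\<lambda>p. z p i n) \<longlongrightarrow> e (J + i) n) F" if i: "i < d" for i n
    using tendsto_with_boundary[OF F, of "b i" "e (J + i)" n] with_boundary_self[OF e_dom, of "J + i"] i J(1)
    by (simp add: z_def flip: b[OF i])
  have lim_v: "((\<lambda>p. v p i n) \<longlongrightarrow> complex_of_real (\<mu> (J + i) - c) * e (J + i) n) F"
    if i: "i < d" and n: "1 \<le> n" "n \<le> N" for i n
  proof -
    have "((\<lambda>p. v p i n) \<longlongrightarrow> op (e (J + i)) n - complex_of_real c * e (J + i) n) F"
      unfolding v_def by (intro tendsto_intros tendsto_sl_operator[OF F] lim_z i n)
    then show ?thesis using op_e[of "J + i" n] i n J(1) by (simp add: algebra_simps)
  qed
  have lim_D: "((\<lambda>p. D p i j) \<longlongrightarrow> complex_of_real (if i = j then \<delta> i else 0)) F" if ij: "i < d" "j < d" for i j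
  proof -
    have "((\<lambda>p. D p i j) \<longlongrightarrow>
        ip (\<lambda>n. complex_of_real (\<mu> (J + i) - c) * e (J + i) n) (\<lambda>n. complex_of_real (\<mu> (J + j) - c) * e (J + j) n)
        - complex_of_real (s\<^sup>2) * ip (e (J + i)) (e (J + j))) F"
      unfolding D_def by (intro tendsto_intros tendsto_sl_inner[OF F] lim_z lim_v ij)
    also have "ip (\<lambda>n. complex_of_real (\<mu> (J + i) - c) * e (J + i) n) (\<lambda>n. complex_of_real (\<mu> (J + j) - c) * e (J + j) n)
        - complex_of_real (s\<^sup>2) * ip (e (J + i)) (e (J + j)) = complex_of_real (if i = j then \<delta> i else 0)"
      unfolding ip_scale_left ip_scale_right
      using ij J(1) by (simp add: orthonormal \<delta>_def power2_eq_square)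
    finally show ?thesis .
  qed
  have "\<forall>\<^sub>F p in F. \<forall>i\<in>{..<d}. \<forall>j\<in>{..<d}.
      dist (D p i j) (complex_of_real (if i = j then \<delta> i else 0)) < \<kappa> / (real d + 1)"
    using \<open>\<kappa> > 0\<close> by (intro eventually_ball_finite ballI finite_lessThan tendstoD lim_D) auto
  then show ?thesis
  proof (rule eventually_mono, intro allI impI)
    fix p k' e' \<mu>'
    assume near: "\<forall>i\<in>{..<d}. \<forall>j\<in>{..<d}.
        dist (D p i j) (complex_of_real (if i = j then \<delta> i else 0)) < \<kappa> / (real d + 1)"
    assume "sl_eigenbasis N (fst p) (snd p) k' e' \<mu>'"
    then interpret p: sl_eigenbasis N "fst p" "snd p" k' e' \<mu>' .
    show "d \<le> card {j. j < k' \<and> \<bar>\<mu>' j - c\<bar> \<le> s}"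
    proof (rule p.eigenvalues_near[of d "z p"])
      show "z p i \<in> sl_domain N (fst p) (snd p)" for i
        unfolding z_def by (intro p.with_boundary_in_dom lagrange_vector_in_kernel p.sa)
      show "0 \<le> s" using assms by simp
      fix x :: "nat \<Rightarrow> complex" assume "\<exists>i<d. x i \<noteq> 0"
      then have "Re (\<Sum>i<d. \<Sum>j<d. x i * cnj (x j) * D p i j) < 0"
        using near \<delta> \<open>\<kappa> > 0\<close>
        by (intro near_negative_diagonal_form_negative[of \<kappa> d \<delta>]) (auto simp: dist_norm less_imp_le)
      then show "Re (\<Sum>i<d. \<Sum>j<d. x i * cnj (x j) *
          (sl_inner N (fst p) (\<lambda>n. sl_operator (fst p) (z p i) n - complex_of_real c * z p i n)
             (\<lambda>n. sl_operator (fst p) (z p j) n - complex_of_real c * z p j n)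
           - complex_of_real (s\<^sup>2) * sl_inner N (fst p) (z p i) (z p j))) < 0"
        by (simp only: D_def v_def[abs_def])
    qed
  qed
qed

section \<open>Change of representative and the projection to classes\<close>

lemma rank_mult_le:
  fixes A :: "'a::field^'n^'m" and B :: "'a^'l^'n"
  shows "rank (A ** B) \<le> rank B"
proof -
  have "row i (A ** B) = (\<Sum>k\<in>UNIV. A $ i $ k *s row k B)" for i
    by (simp add: vec_eq_iff row_def matrix_matrix_mult_def)
  moreover have "(\<Sum>k\<in>UNIV. A $ i $ k *s row k B) \<in> vec.span (rows B)" for i
    by (intro vec.span_sum vec.span_scale vec.span_base) (auto simp: rows_def)
  ultimately have "rows (A ** B) \<subseteq> vec.span (rows B)"
    by (auto simp: rows_def)
  then show ?thesis unfolding row_rank_def_gen by (rule vec.dim_mono)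
qed

lemma invertible_rank_mult:
  fixes G :: "'a::field^'n^'n" and B :: "'a^'l^'n"
  assumes "invertible G"
  shows "rank (G ** B) = rank B"
proof (rule antisym[OF rank_mult_le])
  obtain H where "H ** G = mat 1" using assms by (auto simp: invertible_def)
  then have "B = H ** (G ** B)" by (simp add: matrix_mul_assoc)
  then show "rank B \<le> rank (G ** B)" by (metis rank_mult_le)
qed

lemma bc_class_mult:
  assumes "invertible G"
  shows "bc_class (G ** B) = bc_class B"
proof
  obtain H where H: "H ** G = mat 1" "G ** H = mat 1" using assms by (auto simp: invertible_def)
  then have "invertible H" by (auto simp: invertible_def)
  show "bc_class (G ** B) \<subseteq> bc_class B"
    using assms by (auto simp: bc_class_def matrix_mul_assoc intro: invertible_mult)
  show "bc_class B \<subseteq> bc_class (G ** B)"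
  proof
    fix X assume "X \<in> bc_class B"
    then obtain K where K: "invertible K" "X = K ** B" by (auto simp: bc_class_def)
    have "X = (K ** H) ** (G ** B)"
      using H(1) K(2) by (metis matrix_mul_assoc matrix_mul_rid)
    then show "X \<in> bc_class (G ** B)"
      using invertible_mult[OF K(1) \<open>invertible H\<close>] unfolding bc_class_def by blast
  qed
qed

lemma self_adjoint_matrix_mult:
  assumes "self_adjoint_matrix M"
  shows "self_adjoint_matrix (G ** M)"
proof -
  have 1: "left_block (G ** M) = G ** left_block M" "right_block (G ** M) = G ** right_block M"
    by (simp_all add: left_block_def right_block_def matrix_matrix_mult_def)
  have 2: "conj_transpose (G ** X) = conj_transpose X ** conj_transpose G" for X :: "complex^2^2"
    by (simp add: conj_transpose_def matrix_matrix_mult_def vec_eq_iff mult.commute)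
  have "G ** X ** symplectic_J ** conj_transpose (G ** X)
      = G ** (X ** symplectic_J ** conj_transpose X) ** conj_transpose G" for X
    by (simp add: 2 matrix_mul_assoc)
  then show ?thesis using assms by (simp only: self_adjoint_matrix_def 1)
qed

text \<open>The projection to the quotient is open: the saturation of an open set is a union of its translates.\<close>

lemma openin_bc_topology_near:
  assumes "open U"
  shows "openin bc_topology {A \<in> sa_boundary_conditions. \<exists>M\<in>U. rank M = 2 \<and> self_adjoint_matrix M \<and> A = bc_class M}"
proof -
  define T where "T = (\<Union>G\<in>Collect invertible. (\<lambda>M. G ** M) -` U :: bc_matrix set)"
  have "continuous_on UNIV (\<lambda>M :: bc_matrix. G ** M)" for G
    unfolding matrix_matrix_mult_def by (intro continuous_on_vec_lambda continuous_intros)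
  then have "open T"
    unfolding T_def using assms by (intro open_UN ballI open_vimage) auto
  have T_class: "M' \<in> T" if eq: "bc_class M' = bc_class M" and M: "M \<in> T" for M M'
  proof -
    obtain G where G: "invertible G" "G ** M \<in> U" using M by (auto simp: T_def)
    have "G ** M \<in> bc_class M'" using G(1) eq unfolding bc_class_def by blast
    then show ?thesis using G(2) by (auto simp: bc_class_def T_def)
  qed
  let ?W = "bc_class ` (T \<inter> {M. rank M = 2})"
  have "{M \<in> {M. rank M = 2}. bc_class M \<in> ?W} = T \<inter> {M. rank M = 2}"
    using T_class by blast
  then have "openin (quotient_topology (top_of_set {M. rank M = 2}) bc_class) ?W"
    using \<open>open T\<close> by (auto simp: openin_quotient_topology openin_open)
  moreover have "{A \<in> sa_boundary_conditions. \<exists>M\<in>U. rank M = 2 \<and> self_adjoint_matrix M \<and> A = bc_class M}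
      = ?W \<inter> sa_boundary_conditions" (is "?L = ?R")
  proof
    show "?L \<subseteq> ?R"
    proof
      fix A assume "A \<in> ?L"
      then obtain M where "A \<in> sa_boundary_conditions" "M \<in> U" "rank M = 2" "A = bc_class M" by blast
      moreover have "M \<in> T"
        using \<open>M \<in> U\<close> unfolding T_def by (intro UN_I[of "mat 1"]) (auto simp: invertible_def intro: exI[of _ "mat 1"])
      ultimately show "A \<in> ?R" by blast
    qed
    show "?R \<subseteq> ?L"
    proof
      fix A assume "A \<in> ?R"
      then obtain M G M' where A: "A \<in> sa_boundary_conditions" "A = bc_class M" "rank M = 2"
        "invertible G" "G ** M \<in> U" "A = bc_class M'" "self_adjoint_matrix M'"
        by (auto simp: T_def sa_boundary_conditions_def)
      \<comment> \<open>\<open>M\<close> is only known to have rank 2; self-adjointness of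
        \<open>G ** M\<close> is inherited from the representative \<open>M'\<close> of the same
        class.\<close>
      have "G ** M \<in> bc_class M" using A(4) unfolding bc_class_def by blast
      then obtain K where "G ** M = K ** M'" using A(2,6) by (auto simp: bc_class_def)
      then have "self_adjoint_matrix (G ** M)" using self_adjoint_matrix_mult[OF A(7)] by simp
      then show "A \<in> ?L"
        using A invertible_rank_mult[OF A(4), of M] bc_class_mult[OF A(4), of M]
        by (intro CollectI conjI bexI[of _ "G ** M"]) auto
    qed
  qed
  ultimately show ?thesis unfolding bc_topology_def openin_subtopology by blast
qed

lemma tendsto_coefficient:
  assumes f: "continuous_map (coeff_topology N) euclideanreal f" and P0: "P0 \<in> topspace (slp_topology N)"
  shows "((\<lambda>P. f (fst P)) \<longlongrightarrow> f (fst P0)) (atin_within (slp_topology N) P0 S)"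
proof -
  have "continuous_map (slp_topology N) (subtopology (coeff_topology N) (sl_equations N)) fst"
    unfolding slp_topology_def by (rule continuous_map_fst)
  then have "continuous_map (slp_topology N) euclideanreal (f \<circ> fst)"
    using continuous_map_compose continuous_map_from_subtopology[OF f] by blast
  then have "limitin euclideanreal (f \<circ> fst) ((f \<circ> fst) P0) (atin (slp_topology N) P0)"
    using P0 by (intro limitin_continuous_map) auto
  then have "((\<lambda>P. f (fst P)) \<longlongrightarrow> f (fst P0)) (atin (slp_topology N) P0)" by (simp add: o_def)
  then show ?thesis
    by (rule filterlim_mono[OF _ order_refl]) (unfold atin_within_def, intro inf_mono order_refl, auto)
qed

section \<open>Limits of the eigenvalues\<close>

text \<open>Openness of the projection carries a neighbourhood of \<open>M0\<close> to one of its
  class. The representative obtained need not vary continuously with \<open>P\<close>.\<close>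

lemma eventually_bc_representative:
  assumes P0: "P0 \<in> topspace (slp_topology N)" "snd P0 = bc_class M0" "rank M0 = 2" "self_adjoint_matrix M0"
    and Q: "eventually Q (nhds M0)"
  shows "\<forall>\<^sub>F P in atin_within (slp_topology N) P0 S.
    \<exists>M. snd P = bc_class M \<and> rank M = 2 \<and> self_adjoint_matrix M \<and> Q M"
proof -
  obtain U where U: "open U" "M0 \<in> U" "\<And>M. M \<in> U \<Longrightarrow> Q M"
    using Q by (auto simp: eventually_nhds)
  define W where "W = {A \<in> sa_boundary_conditions. \<exists>M\<in>U. rank M = 2 \<and> self_adjoint_matrix M \<and> A = bc_class M}"
  have "openin (slp_topology N) (sl_equations N \<times> W)"
    unfolding slp_topology_def openin_prod_Times_iff
    using openin_bc_topology_near[OF U(1)] openin_topspace[of "subtopology (coeff_topology N) (sl_equations N)"]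
    by (simp add: W_def sl_equations_def Int_absorb1)
       (metis (no_types, lifting) inf.absorb_iff2 mem_Collect_eq subsetI case_prodE openin_topspace topspace_subtopology)
  moreover have "P0 \<in> sl_equations N \<times> W"
    using P0 U(2) by (cases P0) (auto simp: topspace_slp_topology W_def)
  ultimately show ?thesis
    unfolding eventually_atin_within
    by (intro disjI2 exI[of _ "sl_equations N \<times> W"]) (auto simp: W_def dest: U(3))
qed

lemma eigenvalue_count_lower_semicontinuous:
  assumes N: "2 \<le> N" and P0: "P0 \<in> topspace (slp_topology N)"
    and J: "J + d \<le> num_eigenvalues N P0"
    and near: "\<And>i. i < d \<Longrightarrow> a \<le> eigenvalue N (J + i) P0 \<and> eigenvalue N (J + i) P0 \<le> b"
    and "a \<le> b" "0 < \<epsilon>"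
  shows "\<forall>\<^sub>F P in atin_within (slp_topology N) P0 S.
    d \<le> card {j. j < num_eigenvalues N P \<and> a - \<epsilon> \<le> eigenvalue N j P \<and> eigenvalue N j P \<le> b + \<epsilon>}"
proof -
  let ?A = "atin_within (slp_topology N) P0 S"
  obtain \<omega>0 M0 where P0_eq: "P0 = (\<omega>0, bc_class M0)" and M0: "rank M0 = 2" "self_adjoint_matrix M0"
    and \<omega>0: "\<omega>0 \<in> sl_equations N"
    using P0 by (auto simp: topspace_slp_topology sa_boundary_conditions_def)
  have regular: "regular_sl N \<omega> M" if "\<omega> \<in> sl_equations N" "rank M = 2" "self_adjoint_matrix M" for \<omega> M
    using that N by unfold_locales (auto simp: regular_slp_def sl_equations_def sl_w_def)
  interpret P0: regular_sl N \<omega>0 M0 by (rule regular[OF \<omega>0 M0])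
  obtain e where "sl_eigenbasis N \<omega>0 M0 (num_eigenvalues N P0) e (\<lambda>j. eigenvalue N j P0)"
    unfolding P0_eq by (rule P0.eigenbasis_exists[OF refl])
  then interpret E: sl_eigenbasis N \<omega>0 M0 "num_eigenvalues N P0" e "\<lambda>j. eigenvalue N j P0" .
  \<comment> \<open>A product filter: the coefficients follow \<open>P\<close>, while the matrix
    ranges over all neighbours of \<open>M0\<close>. An eventual property splits into
    \<open>Q1\<close> and \<open>Q2\<close>, and only then is a representative satisfying
    \<open>Q2\<close> chosen for each \<open>P\<close>.\<close>
  define F where "F = filtermap fst ?A \<times>\<^sub>F nhds M0"
  have coeff: "((\<lambda>p. f (fst p)) \<longlongrightarrow> f \<omega>0) F" if "continuous_map (coeff_topology N) euclideanreal f" for f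
  proof -
    have "(f \<longlongrightarrow> f \<omega>0) (filtermap fst ?A)"
      using tendsto_coefficient[OF that P0] by (simp add: filterlim_filtermap P0_eq)
    then show ?thesis
      unfolding F_def by (rule filterlim_compose[OF _ filterlim_fst])
  qed
  have "approaches N F \<omega>0 M0"
    unfolding approaches_def
  proof (intro conjI ballI)
    show "(snd \<longlongrightarrow> M0) F" unfolding F_def by (rule filterlim_snd)
  next
    fix n assume n: "n \<in> {0..N}"
    have "continuous_map (coeff_topology N) euclideanreal ((\<lambda>g. g n) \<circ> fst)"
      unfolding coeff_topology_def
      by (intro continuous_map_compose[OF continuous_map_fst] continuous_map_product_projection n)
    from coeff[OF this] show "((\<lambda>p. fst (fst p) n) \<longlongrightarrow> fst \<omega>0 n) F" by (simp add: o_def)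
  next
    fix n assume n: "n \<in> {1..N}"
    have "continuous_map (coeff_topology N) euclideanreal ((\<lambda>q. q n) \<circ> (fst \<circ> snd))"
      unfolding coeff_topology_def
      by (rule continuous_map_compose[OF continuous_map_compose[OF continuous_map_snd continuous_map_fst]
            continuous_map_product_projection[OF n]])
    from coeff[OF this] show "((\<lambda>p. sl_q (fst p) n) \<longlongrightarrow> sl_q \<omega>0 n) F" by (simp add: o_def sl_q_def)
  next
    fix n assume n: "n \<in> {1..N}"
    have "continuous_map (coeff_topology N) euclideanreal ((\<lambda>w. w n) \<circ> (snd \<circ> snd))"
      unfolding coeff_topology_def
      by (rule continuous_map_compose[OF continuous_map_compose[OF continuous_map_snd continuous_map_snd]
            continuous_map_product_projection[OF n]])
    from coeff[OF this] show "((\<lambda>p. sl_w (fst p) n) \<longlongrightarrow> sl_w \<omega>0 n) F" by (simp add: o_def sl_w_def)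
  qed
  then have "\<forall>\<^sub>F p in F. \<forall>k e \<mu>. sl_eigenbasis N (fst p) (snd p) k e \<mu> \<longrightarrow>
      d \<le> card {j. j < k \<and> \<bar>\<mu> j - (a + b) / 2\<bar> \<le> (b - a) / 2 + \<epsilon>}"
  proof (rule E.eigenvalues_persist[OF _ J])
    \<comment> \<open>[a, b] is the ball about its midpoint whose radius is half its length.\<close>
    show "\<bar>eigenvalue N (J + i) P0 - (a + b) / 2\<bar> \<le> (b - a) / 2" if "i < d" for i
      using near[OF that] by (intro abs_leI) (simp_all add: field_simps)
  qed (use \<open>a \<le> b\<close> \<open>0 < \<epsilon>\<close> in auto)
  then obtain Q1 Q2 where Q: "eventually Q1 (filtermap fst ?A)" "eventually Q2 (nhds M0)"
    and key: "\<And>\<omega> M k e \<mu>. Q1 \<omega> \<Longrightarrow> Q2 M \<Longrightarrow> sl_eigenbasis N \<omega> M k e \<mu> \<Longrightarrow>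
      d \<le> card {j. j < k \<and> \<bar>\<mu> j - (a + b) / 2\<bar> \<le> (b - a) / 2 + \<epsilon>}"
    unfolding F_def eventually_prod_filter by force
  have "\<forall>\<^sub>F P in ?A. P \<in> topspace (slp_topology N)"
    unfolding eventually_atin_within using P0 openin_topspace by blast
  moreover have "\<forall>\<^sub>F P in ?A. Q1 (fst P)" using Q(1) by (simp add: eventually_filtermap)
  moreover have "\<forall>\<^sub>F P in ?A. \<exists>M. snd P = bc_class M \<and> rank M = 2 \<and> self_adjoint_matrix M \<and> Q2 M"
    by (rule eventually_bc_representative[OF P0 _ M0 Q(2)]) (simp add: P0_eq)
  ultimately show ?thesis
  proof eventually_elim
    case (elim P)
    then obtain \<omega> M where P: "P = (\<omega>, bc_class M)" "\<omega> \<in> sl_equations N" "rank M = 2" "self_adjoint_matrix M"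
      "Q1 \<omega>" "Q2 M"
      by (cases P) (auto simp: topspace_slp_topology)
    interpret P: regular_sl N \<omega> M by (rule regular) fact+
    obtain e where "sl_eigenbasis N \<omega> M (num_eigenvalues N P) e (\<lambda>j. eigenvalue N j P)"
      unfolding P(1) by (rule P.eigenbasis_exists[OF refl])
    from key[OF P(5,6) this]
    have "d \<le> card {j. j < num_eigenvalues N P \<and> \<bar>eigenvalue N j P - (a + b) / 2\<bar> \<le> (b - a) / 2 + \<epsilon>}" .
    also have "{j. j < num_eigenvalues N P \<and> \<bar>eigenvalue N j P - (a + b) / 2\<bar> \<le> (b - a) / 2 + \<epsilon>} =
        {j. j < num_eigenvalues N P \<and> a - \<epsilon> \<le> eigenvalue N j P \<and> eigenvalue N j P \<le> b + \<epsilon>}"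
      by (intro Collect_cong conj_cong refl) (auto simp: abs_le_iff field_simps)
    finally show ?case .
  qed
qed

theorem theorem2p2:
  fixes N k m :: nat and \<O> :: "slp set" and P0 :: slp
  assumes "N \<ge> 2" and "k \<ge> 2"
    and "\<O> \<subseteq> sl_equations N \<times> sa_boundary_conditions"
    and "\<forall>P\<in>\<O>. num_eigenvalues N P = k"
    and "P0 \<in> (slp_topology N closure_of \<O>) - \<O>"
    and "num_eigenvalues N P0 = m"
    and "0 < m" and "m \<le> k - 1"
  shows
    "((\<forall>n\<in>{0..k - m - 1}.
         filterlim (eigenvalue N n) at_bot (atin_within (slp_topology N) P0 \<O>)) \<longrightarrow>
      (\<forall>n\<in>{k - m..k - 1}.
         (eigenvalue N n \<longlongrightarrow> eigenvalue N (n - (k - m)) P0)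
           (atin_within (slp_topology N) P0 \<O>))) \<and>
     ((\<forall>n\<in>{m..k - 1}.
         filterlim (eigenvalue N n) at_top (atin_within (slp_topology N) P0 \<O>)) \<longrightarrow>
      (\<forall>n\<in>{0..m - 1}.
         (eigenvalue N n \<longlongrightarrow> eigenvalue N n P0)
           (atin_within (slp_topology N) P0 \<O>)))"
proof -
  let ?A = "atin_within (slp_topology N) P0 \<O>"
  have P0: "P0 \<in> topspace (slp_topology N)" using assms(5) in_closure_of by fastforce
  have in_O: "\<forall>\<^sub>F P in ?A. P \<in> \<O>"
    unfolding eventually_atin_within using P0 openin_topspace by blast
  have num: "num_eigenvalues N P = k" if "P \<in> \<O>" for P using assms(4) that by blast
  have mono: "eigenvalue N i P \<le> eigenvalue N j P" if "P \<in> \<O>" "i \<le> j" "j < k" for P i j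
    using eigenvalue_mono num that by blast
  have mono0: "eigenvalue N i P0 \<le> eigenvalue N j P0" if "i \<le> j" "j < m" for i j
    using eigenvalue_mono assms(6) that by blast
  \<comment> \<open>The windows in \<open>low\<close> and \<open>high\<close> join the ith limit
    eigenvalue to the lowest and to the highest one. Their counts yield the upper and the lower
    estimate respectively.\<close>
  define lo hi where "lo = eigenvalue N 0 P0" and "hi = eigenvalue N (m - 1) P0"
  have low: "\<forall>\<^sub>F P in ?A. i + 1 \<le> card {j. j < k \<and> lo - \<epsilon> \<le> eigenvalue N j P \<and> eigenvalue N j P \<le> eigenvalue N i P0 + \<epsilon>}"
    if "i < m" "0 < \<epsilon>" for i \<epsilon>
  proof -
    have "\<forall>\<^sub>F P in ?A. i + 1 \<le> card {j. j < num_eigenvalues N P \<and> lo - \<epsilon> \<le> eigenvalue N j P \<and> eigenvalue N j P \<le> eigenvalue N i P0 + \<epsilon>}"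
      by (rule eigenvalue_count_lower_semicontinuous[where J = 0])
        (use assms that P0 mono0 in \<open>auto simp: lo_def\<close>)
    with in_O show ?thesis by eventually_elim (simp add: num)
  qed
  have high: "\<forall>\<^sub>F P in ?A. m - i \<le> card {j. j < k \<and> eigenvalue N i P0 - \<epsilon> \<le> eigenvalue N j P \<and> eigenvalue N j P \<le> hi + \<epsilon>}"
    if "i < m" "0 < \<epsilon>" for i \<epsilon>
  proof -
    have "\<forall>\<^sub>F P in ?A. m - i \<le> card {j. j < num_eigenvalues N P \<and> eigenvalue N i P0 - \<epsilon> \<le> eigenvalue N j P \<and> eigenvalue N j P \<le> hi + \<epsilon>}"
      by (rule eigenvalue_count_lower_semicontinuous[where J = i])
        (use assms that P0 mono0 in \<open>auto simp: hi_def\<close>)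
    with in_O show ?thesis by eventually_elim (simp add: num)
  qed
  have card_subset: "\<not> c < d" if "d \<le> card X" "X \<subseteq> {p..<q}" "q - p = c" for c d p q :: nat and X
    using card_mono[OF _ that(2)] that by simp
  show ?thesis
  proof (intro conjI impI ballI)
    fix n
    assume lim: "\<forall>n\<in>{0..k - m - 1}. filterlim (eigenvalue N n) at_bot ?A" and n: "n \<in> {k - m..k - 1}"
    define i where "i = n - (k - m)"
    have i: "i < m" "n = k - m + i" "n < k" using n assms(2,7,8) by (auto simp: i_def)
    show "(eigenvalue N n \<longlongrightarrow> eigenvalue N (n - (k - m)) P0) ?A"
      unfolding i_def[symmetric]
    proof (rule tendstoI)
      fix \<epsilon>' :: real assume "0 < \<epsilon>'"
      \<comment> \<open>The windows are closed, whereas the limit asks for a strict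
        inequality.\<close>
      define \<epsilon> where "\<epsilon> = \<epsilon>' / 2"
      have \<epsilon>: "0 < \<epsilon>" "\<epsilon> < \<epsilon>'" using \<open>0 < \<epsilon>'\<close> by (auto simp: \<epsilon>_def)
      have "\<forall>\<^sub>F P in ?A. \<forall>j\<in>{0..k - m - 1}. eigenvalue N j P < lo - \<epsilon>"
        using lim by (intro eventually_ball_finite ballI) (auto simp: filterlim_at_bot_dense)
      with in_O low[OF i(1) \<epsilon>(1)] high[OF i(1) \<epsilon>(1)]
      show "\<forall>\<^sub>F P in ?A. dist (eigenvalue N n P) (eigenvalue N i P0) < \<epsilon>'"
      proof eventually_elim
        case (elim P)
        \<comment> \<open>Otherwise the window of \<open>low\<close> holds at most the indices k -
          m, ..., n - 1, the lower ones having escaped. These are i in number, against the i + 1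
          guaranteed.\<close>
        have "eigenvalue N n P \<le> eigenvalue N i P0 + \<epsilon>"
        proof (rule ccontr)
          assume "\<not> ?thesis"
          then have "j < n" if "j < k" "eigenvalue N j P \<le> eigenvalue N i P0 + \<epsilon>" for j
            using mono[OF elim(1), of n j] that by linarith
          moreover have "k - m \<le> j" if "lo - \<epsilon> \<le> eigenvalue N j P" for j
            using elim(4)[rule_format, of j] that by fastforce
          ultimately have "{j. j < k \<and> lo - \<epsilon> \<le> eigenvalue N j P \<and> eigenvalue N j P \<le> eigenvalue N i P0 + \<epsilon>} \<subseteq> {k - m..<n}"
            by auto
          from card_subset[OF elim(2) this, of i] show False using i by simp
        qed
        \<comment> \<open>Otherwise only n + 1, ..., k - 1 remain for the window of
          \<open>high\<close>: m - i - 1 indices, as n = k - m + i.\<close>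
        moreover have "eigenvalue N i P0 - \<epsilon> \<le> eigenvalue N n P"
        proof (rule ccontr)
          assume "\<not> ?thesis"
          then have "n < j" if "eigenvalue N i P0 - \<epsilon> \<le> eigenvalue N j P" for j
            using mono[OF elim(1) _ i(3), of j] that by linarith
          then have "{j. j < k \<and> eigenvalue N i P0 - \<epsilon> \<le> eigenvalue N j P \<and> eigenvalue N j P \<le> hi + \<epsilon>} \<subseteq> {n + 1..<k}"
            by (auto simp: Suc_le_eq)
          from card_subset[OF elim(3) this refl] show False using i by simp
        qed
        ultimately show ?case using \<epsilon> by (simp add: dist_real_def)
      qed
    qed
  next
    fix n
    assume lim: "\<forall>n\<in>{m..k - 1}. filterlim (eigenvalue N n) at_top ?A" and n: "n \<in> {0..m - 1}"
    have n: "n < m" "n < k" using n assms(2,7,8) by auto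
    show "(eigenvalue N n \<longlongrightarrow> eigenvalue N n P0) ?A"
    proof (rule tendstoI)
      fix \<epsilon>' :: real assume "0 < \<epsilon>'"
      define \<epsilon> where "\<epsilon> = \<epsilon>' / 2"
      have \<epsilon>: "0 < \<epsilon>" "\<epsilon> < \<epsilon>'" using \<open>0 < \<epsilon>'\<close> by (auto simp: \<epsilon>_def)
      have "\<forall>\<^sub>F P in ?A. \<forall>j\<in>{m..k - 1}. hi + \<epsilon> < eigenvalue N j P"
        using lim by (intro eventually_ball_finite ballI) (auto simp: filterlim_at_top_dense)
      with in_O low[OF n(1) \<epsilon>(1)] high[OF n(1) \<epsilon>(1)]
      show "\<forall>\<^sub>F P in ?A. dist (eigenvalue N n P) (eigenvalue N n P0) < \<epsilon>'"
      proof eventually_elim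
        case (elim P)
        have "eigenvalue N n P \<le> eigenvalue N n P0 + \<epsilon>"
        proof (rule ccontr)
          assume "\<not> ?thesis"
          then have "j < n" if "j < k" "eigenvalue N j P \<le> eigenvalue N n P0 + \<epsilon>" for j
            using mono[OF elim(1), of n j] that by linarith
          then have "{j. j < k \<and> lo - \<epsilon> \<le> eigenvalue N j P \<and> eigenvalue N j P \<le> eigenvalue N n P0 + \<epsilon>} \<subseteq> {0..<n}"
            by auto
          from card_subset[OF elim(2) this refl] show False by simp
        qed
        \<comment> \<open>Here the escape keeps the indices from m on above
          \<open>hi + \<epsilon>\<close>, so only n + 1, ..., m - 1 could remain, one fewer than
          \<open>high\<close> guarantees.\<close>
        moreover have "eigenvalue N n P0 - \<epsilon> \<le> eigenvalue N n P"
        proof (rule ccontr)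
          assume "\<not> ?thesis"
          then have "n < j" if "eigenvalue N n P0 - \<epsilon> \<le> eigenvalue N j P" for j
            using mono[OF elim(1) _ n(2), of j] that by linarith
          moreover have "j < m" if "j < k" "eigenvalue N j P \<le> hi + \<epsilon>" for j
            using elim(4)[rule_format, of j] that by fastforce
          ultimately have "{j. j < k \<and> eigenvalue N n P0 - \<epsilon> \<le> eigenvalue N j P \<and> eigenvalue N j P \<le> hi + \<epsilon>} \<subseteq> {n + 1..<m}"
            by (auto simp: Suc_le_eq)
          from card_subset[OF elim(3) this refl] show False using n by simp
        qed
        ultimately show ?case using \<epsilon> by (simp add: dist_real_def)
      qed
    qed
  qed
qed

end
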